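(* Let $A$ and $B$ be finitely generated groups with $\operatorname{asdim}A\le n$ and $\operatorname{asdim}B\le n$, and let $C$ be their common subgroup. Then the amalgamated product satisfies $\operatorname{asdim}A\ast_CB\le 2n+1$.
   Context: Two sets $U_1,U_2$ in a metric space are $d$-disjoint if $\inf\{\operatorname{dist}(x_1,x_2)\mid x_1\in U_1,\ x_2\in U_2\}\ge d$; a family of sets is $d$-disjoint if any two distinct members are. A metric space $X$ satisfies $\operatorname{asdim}X\le n$ if for every (arbitrarily large) $d>0$ there are $n+1$ uniformly bounded $d$-disjoint families of subsets of $X$ whose union covers $X$ (uniformly bounded: diameters bounded by a common constant). A finitely generated group $\Gamma$ carries the left-invariant word metric $d_S(x,y)$ = the word length of $x^{-1}y$ with respect to a finite generating set $S$; $\operatorname{asdim}\Gamma$ means $\operatorname{asdim}(\Gamma,d_S)$, which does not depend on $S$. "Common subgroup" means that $C$ is a group with fixed injective homomorphisms into $A$ and into $B$; $A\ast_CB$ is the corresponding free product with amalgamation. No finiteness assumption is made on $C$. *)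

theory Defs
  imports "HOL-Analysis.Analysis" "HOL-Algebra.Generated_Groups"
begin

section \<open>Asymptotic dimension\<close>

context Metric_space
begin

text \<open>The infimum is taken in \<^typ>\<open>ereal\<close>, so it is \<open>\<infinity>\<close> when one of the sets is empty.\<close>

definition disjoint_at_scale :: "real \<Rightarrow> 'a set \<Rightarrow> 'a set \<Rightarrow> bool" where
  "disjoint_at_scale r U V \<longleftrightarrow> (INF x\<in>U. INF y\<in>V. ereal (d x y)) \<ge> ereal r"

definition disjoint_family_at_scale :: "real \<Rightarrow> 'a set set \<Rightarrow> bool" where
  "disjoint_family_at_scale r \<F> \<longleftrightarrow> pairwise (disjoint_at_scale r) \<F>"

definition uniformly_bounded :: "'a set set \<Rightarrow> bool" where
  "uniformly_bounded \<F> \<longleftrightarrow> (\<exists>D. \<forall>U\<in>\<F>. \<forall>x\<in>U. \<forall>y\<in>U. d x y \<le> D)"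

definition asdim_le :: "nat \<Rightarrow> bool" where
  "asdim_le n \<longleftrightarrow>
     (\<forall>r>0. \<exists>\<F> :: nat \<Rightarrow> 'a set set.
        (\<forall>i\<le>n. (\<forall>U\<in>\<F> i. U \<subseteq> M) \<and> uniformly_bounded (\<F> i) \<and> disjoint_family_at_scale r (\<F> i)) \<and>
        M \<subseteq> (\<Union>i\<le>n. \<Union>(\<F> i)))"

lemma disjoint_at_scale_iff:
  "disjoint_at_scale r U V \<longleftrightarrow> (\<forall>x\<in>U. \<forall>y\<in>V. r \<le> d x y)"
  by (simp add: disjoint_at_scale_def le_INF_iff)

end

section \<open>Word metrics\<close>

definition finite_generating_set :: "('a, 'm) monoid_scheme \<Rightarrow> 'a set \<Rightarrow> bool" where
  "finite_generating_set G S \<longleftrightarrow> finite S \<and> S \<subseteq> carrier G \<and> generate G S = carrier G"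

definition word_length :: "('a, 'm) monoid_scheme \<Rightarrow> 'a set \<Rightarrow> 'a \<Rightarrow> nat" where
  "word_length G S x =
     (LEAST k. \<exists>ws. set ws \<subseteq> S \<union> m_inv G ` S \<and> length ws = k \<and>
                    foldr (\<otimes>\<^bsub>G\<^esub>) ws \<one>\<^bsub>G\<^esub> = x)"

text \<open>
  The locale \<^locale>\<open>Metric_space\<close> requires symmetry on the whole type, hence the dummy value
  outside the carrier.
\<close>

definition word_dist :: "('a, 'm) monoid_scheme \<Rightarrow> 'a set \<Rightarrow> 'a \<Rightarrow> 'a \<Rightarrow> real" where
  "word_dist G S x y =
     (if x \<in> carrier G \<and> y \<in> carrier G
      then real (word_length G S (inv\<^bsub>G\<^esub> x \<otimes>\<^bsub>G\<^esub> y)) else 0)"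

context group
begin

lemma foldr_closed: "set ws \<subseteq> carrier G \<Longrightarrow> foldr (\<otimes>) ws \<one> \<in> carrier G"
  by (induction ws) auto

lemma foldr_append:
  "set us \<subseteq> carrier G \<Longrightarrow> set vs \<subseteq> carrier G \<Longrightarrow>
   foldr (\<otimes>) (us @ vs) \<one> = foldr (\<otimes>) us \<one> \<otimes> foldr (\<otimes>) vs \<one>"
  by (induction us) (auto simp: foldr_closed m_assoc simp del: foldr_append)

lemma foldr_inv:
  "set ws \<subseteq> carrier G \<Longrightarrow> foldr (\<otimes>) (rev (map (m_inv G) ws)) \<one> = inv (foldr (\<otimes>) ws \<one>)"
proof (induction ws)
  case (Cons w ws)
  have "foldr (\<otimes>) (rev (map (m_inv G) ws) @ [inv w]) \<one>
      = foldr (\<otimes>) (rev (map (m_inv G) ws)) \<one> \<otimes> foldr (\<otimes>) [inv w] \<one>"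
    using Cons.prems by (intro foldr_append) auto
  then show ?case
    using Cons by (simp add: foldr_closed inv_mult_group del: List.foldr_append)
qed simp

lemma word_exists:
  assumes "S \<subseteq> carrier G" "x \<in> generate G S"
  shows "\<exists>ws. set ws \<subseteq> S \<union> m_inv G ` S \<and> foldr (\<otimes>) ws \<one> = x"
  using assms(2)
proof (induction rule: generate.induct)
  case one
  show ?case by (rule exI[of _ "[]"]) simp
next
  case (incl h)
  then show ?case using assms(1) by (intro exI[of _ "[h]"]) auto
next
  case (inv h)
  then show ?case using assms(1) by (intro exI[of _ "[inv h]"]) auto
next
  case (eng g h)
  then obtain us vs where "set us \<subseteq> S \<union> m_inv G ` S" "foldr (\<otimes>) us \<one> = g"
    "set vs \<subseteq> S \<union> m_inv G ` S" "foldr (\<otimes>) vs \<one> = h" by blast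
  moreover from this have "set us \<subseteq> carrier G" "set vs \<subseteq> carrier G"
    using assms(1) by (auto 0 4)
  ultimately show ?case
    by (intro exI[of _ "us @ vs"]) (auto simp: foldr_append simp del: List.foldr_append)
qed

lemma word_length_le:
  assumes "set ws \<subseteq> S \<union> m_inv G ` S" "foldr (\<otimes>) ws \<one> = x"
  shows "word_length G S x \<le> length ws"
  unfolding word_length_def using assms by (intro Least_le) blast

lemma word_length_witness:
  assumes "finite_generating_set G S" "x \<in> carrier G"
  obtains ws where "set ws \<subseteq> S \<union> m_inv G ` S" "set ws \<subseteq> carrier G"
    "length ws = word_length G S x" "foldr (\<otimes>) ws \<one> = x"
proof -
  have S: "S \<subseteq> carrier G" using assms by (simp add: finite_generating_set_def)
  have "\<exists>k ws. set ws \<subseteq> S \<union> m_inv G ` S \<and> length ws = k \<and> foldr (\<otimes>) ws \<one> = x"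
    using word_exists[OF S, of x] assms by (auto simp: finite_generating_set_def)
  from LeastI_ex[OF this] obtain ws where "set ws \<subseteq> S \<union> m_inv G ` S"
    "length ws = word_length G S x" "foldr (\<otimes>) ws \<one> = x"
    unfolding word_length_def by blast
  moreover from this S have "set ws \<subseteq> carrier G" by (auto 0 4)
  ultimately show thesis using that by blast
qed

lemma word_length_mult:
  assumes "finite_generating_set G S" "x \<in> carrier G" "y \<in> carrier G"
  shows "word_length G S (x \<otimes> y) \<le> word_length G S x + word_length G S y"
proof -
  obtain us vs where "set us \<subseteq> S \<union> m_inv G ` S" "set us \<subseteq> carrier G"
    "length us = word_length G S x" "foldr (\<otimes>) us \<one> = x"
    "set vs \<subseteq> S \<union> m_inv G ` S" "set vs \<subseteq> carrier G"
    "length vs = word_length G S y" "foldr (\<otimes>) vs \<one> = y"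
    using word_length_witness assms by metis
  then show ?thesis
    using word_length_le[of "us @ vs" S "x \<otimes> y"]
    by (simp add: foldr_append del: List.foldr_append)
qed

lemma word_length_inv_le:
  assumes "finite_generating_set G S" "x \<in> carrier G"
  shows "word_length G S (inv x) \<le> word_length G S x"
proof -
  obtain ws where ws: "set ws \<subseteq> S \<union> m_inv G ` S" "set ws \<subseteq> carrier G"
    "length ws = word_length G S x" "foldr (\<otimes>) ws \<one> = x"
    using word_length_witness[OF assms] by metis
  have "S \<subseteq> carrier G" using assms by (simp add: finite_generating_set_def)
  then have "set (rev (map (m_inv G) ws)) \<subseteq> S \<union> m_inv G ` S"
    using ws(1) by (auto 0 4 simp: subset_iff)
  then show ?thesis
    using word_length_le[of "rev (map (m_inv G) ws)" S "inv x"] ws by (simp add: foldr_inv)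
qed

lemma word_length_eq_0:
  assumes "finite_generating_set G S" "x \<in> carrier G"
  shows "word_length G S x = 0 \<longleftrightarrow> x = \<one>"
proof
  assume "word_length G S x = 0"
  with word_length_witness[OF assms] show "x = \<one>" by (metis foldr.simps(1) id_apply length_0_conv)
next
  assume "x = \<one>"
  then show "word_length G S x = 0" using word_length_le[of "[]" S x] by simp
qed

theorem word_metric:
  assumes S: "finite_generating_set G S"
  shows "Metric_space (carrier G) (word_dist G S)"
proof
  fix x y z
  show "0 \<le> word_dist G S x y" by (simp add: word_dist_def)
  have *: "word_length G S (inv y \<otimes> x) \<le> word_length G S (inv x \<otimes> y)"
    if "x \<in> carrier G" "y \<in> carrier G" for x y
    using word_length_inv_le[OF S, of "inv x \<otimes> y"] that by (simp add: inv_mult_group)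
  show "word_dist G S x y = word_dist G S y x"
    using *[of x y] *[of y x] by (auto simp: word_dist_def intro: antisym)
  {
    assume "x \<in> carrier G" "y \<in> carrier G"
    then show "word_dist G S x y = 0 \<longleftrightarrow> x = y"
      using inv_equality inv_inv
      by (simp add: word_dist_def word_length_eq_0[OF S]) (metis inv_closed l_inv r_inv inv_comm inv_unique')
    assume "z \<in> carrier G"
    with \<open>x \<in> carrier G\<close> \<open>y \<in> carrier G\<close> show "word_dist G S x z \<le> word_dist G S x y + word_dist G S y z"
      using word_length_mult[OF S, of "inv x \<otimes> y" "inv y \<otimes> z"]
      by (simp add: word_dist_def m_assoc inv_solve_left flip: m_assoc[of y "inv y" z])
  }
qed

end

section \<open>Free products with amalgamation\<close>

text \<open>
  Given \<open>i : C \<rightarrow> A\<close> and \<open>j : C \<rightarrow> B\<close>, the group is presented by the generators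
  \<open>A \<squnion> B\<close>, the multiplication tables of \<open>A\<close> and \<open>B\<close>, and the relations \<open>i c = j c\<close>.
  Its elements are classes of words; formal inverses of letters are not needed because
  every letter already has an inverse letter.
\<close>

abbreviation amalg_words ::
  "('a, 'm) monoid_scheme \<Rightarrow> ('b, 'k) monoid_scheme \<Rightarrow> ('a + 'b) list set" where
  "amalg_words A B \<equiv> lists (carrier A <+> carrier B)"

inductive_set amalg_rel ::
  "('a, 'm) monoid_scheme \<Rightarrow> ('b, 'k) monoid_scheme \<Rightarrow> ('c, 'l) monoid_scheme \<Rightarrow>
   ('c \<Rightarrow> 'a) \<Rightarrow> ('c \<Rightarrow> 'b) \<Rightarrow> (('a + 'b) list \<times> ('a + 'b) list) set"
  for A B C i j where
  refl: "w \<in> amalg_words A B \<Longrightarrow> (w, w) \<in> amalg_rel A B C i j"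
| sym: "(u, v) \<in> amalg_rel A B C i j \<Longrightarrow> (v, u) \<in> amalg_rel A B C i j"
| trans: "(u, v) \<in> amalg_rel A B C i j \<Longrightarrow> (v, w) \<in> amalg_rel A B C i j \<Longrightarrow>
    (u, w) \<in> amalg_rel A B C i j"
| append: "(u, u') \<in> amalg_rel A B C i j \<Longrightarrow> (v, v') \<in> amalg_rel A B C i j \<Longrightarrow>
    (u @ v, u' @ v') \<in> amalg_rel A B C i j"
| one_left: "([Inl \<one>\<^bsub>A\<^esub>], []) \<in> amalg_rel A B C i j"
| one_right: "([Inr \<one>\<^bsub>B\<^esub>], []) \<in> amalg_rel A B C i j"
| mult_left: "a \<in> carrier A \<Longrightarrow> a' \<in> carrier A \<Longrightarrow>
    ([Inl a, Inl a'], [Inl (a \<otimes>\<^bsub>A\<^esub> a')]) \<in> amalg_rel A B C i j"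
| mult_right: "b \<in> carrier B \<Longrightarrow> b' \<in> carrier B \<Longrightarrow>
    ([Inr b, Inr b'], [Inr (b \<otimes>\<^bsub>B\<^esub> b')]) \<in> amalg_rel A B C i j"
| glue: "c \<in> carrier C \<Longrightarrow> ([Inl (i c)], [Inr (j c)]) \<in> amalg_rel A B C i j"

definition amalgamated_product ::
  "('a, 'm) monoid_scheme \<Rightarrow> ('b, 'k) monoid_scheme \<Rightarrow> ('c, 'l) monoid_scheme \<Rightarrow>
   ('c \<Rightarrow> 'a) \<Rightarrow> ('c \<Rightarrow> 'b) \<Rightarrow> ('a + 'b) list set monoid" where
  "amalgamated_product A B C i j =
     \<lparr>carrier = amalg_words A B // amalg_rel A B C i j,
      mult = (\<lambda>P Q. \<Union>u\<in>P. \<Union>v\<in>Q. amalg_rel A B C i j `` {u @ v}),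
      one = amalg_rel A B C i j `` {[]}\<rparr>"

locale amalgam =
  A: group A + B: group B + C: group C
  for A :: "('a, 'm) monoid_scheme" and B :: "('b, 'k) monoid_scheme"
    and C :: "('c, 'l) monoid_scheme" +
  fixes i :: "'c \<Rightarrow> 'a" and j :: "'c \<Rightarrow> 'b"
  assumes i: "i \<in> mon C A" and j: "j \<in> mon C B"
begin

abbreviation "rel \<equiv> amalg_rel A B C i j"
abbreviation "P \<equiv> amalgamated_product A B C i j"
abbreviation "cls w \<equiv> rel `` {w}"

lemma i_closed [simp]: "c \<in> carrier C \<Longrightarrow> i c \<in> carrier A"
  and j_closed [simp]: "c \<in> carrier C \<Longrightarrow> j c \<in> carrier B"
  using i j by (auto simp: mon_def hom_def)

lemma rel_words: "(u, v) \<in> rel \<Longrightarrow> u \<in> amalg_words A B \<and> v \<in> amalg_words A B"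
  by (induction rule: amalg_rel.induct) auto

lemma equiv_rel: "equiv (amalg_words A B) rel"
proof (rule equivI)
  show "rel \<subseteq> amalg_words A B \<times> amalg_words A B" using rel_words by auto
  show "refl_on (amalg_words A B) rel" by (auto simp: refl_on_def intro: amalg_rel.refl)
  show "sym_on UNIV rel" by (auto simp: sym_def intro: amalg_rel.sym)
  show "trans_on UNIV rel" by (auto simp: trans_def intro: amalg_rel.trans)
qed

lemma cls_eq_iff:
  "u \<in> amalg_words A B \<Longrightarrow> v \<in> amalg_words A B \<Longrightarrow> cls u = cls v \<longleftrightarrow> (u, v) \<in> rel"
  by (rule eq_equiv_class_iff[OF equiv_rel])

lemma carrier_P: "carrier P = cls ` amalg_words A B"
  by (auto simp: amalgamated_product_def quotient_def)

lemma one_P: "\<one>\<^bsub>P\<^esub> = cls []"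
  by (simp add: amalgamated_product_def)

lemma mult_P:
  assumes "u \<in> amalg_words A B" "v \<in> amalg_words A B"
  shows "cls u \<otimes>\<^bsub>P\<^esub> cls v = cls (u @ v)"
proof -
  have "(\<lambda>u v. cls (u @ v)) respects2 rel"
    unfolding congruent2_def
    by (auto intro!: equiv_class_eq[OF equiv_rel] amalg_rel.append)
  from UN_equiv_class2[OF equiv_rel equiv_rel this assms] show ?thesis
    by (simp add: amalgamated_product_def)
qed

lemma left_inverse:
  "w \<in> amalg_words A B \<Longrightarrow> \<exists>w'\<in>amalg_words A B. (w' @ w, []) \<in> rel"
proof (induction w)
  case Nil
  then show ?case by (auto intro!: bexI[of _ "[]"] amalg_rel.refl)
next
  case (Cons x w)
  then obtain w' where w': "w' \<in> amalg_words A B" "(w' @ w, []) \<in> rel" by auto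
  have "\<exists>y\<in>carrier A <+> carrier B. ([y, x], []) \<in> rel"
  proof (cases x)
    case (Inl a)
    then have "a \<in> carrier A" using Cons.prems by auto
    then have "([Inl (inv\<^bsub>A\<^esub> a), Inl a], []) \<in> rel"
      using amalg_rel.mult_left[where a = "inv\<^bsub>A\<^esub> a" and a' = a and A = A and B = B and C = C and i = i and j = j]
      by (auto intro: amalg_rel.trans amalg_rel.one_left)
    with Inl \<open>a \<in> carrier A\<close> show ?thesis by auto
  next
    case (Inr b)
    then have "b \<in> carrier B" using Cons.prems by auto
    then have "([Inr (inv\<^bsub>B\<^esub> b), Inr b], []) \<in> rel"
      using amalg_rel.mult_right[where b = "inv\<^bsub>B\<^esub> b" and b' = b and A = A and B = B and C = C and i = i and j = j]
      by (auto intro: amalg_rel.trans amalg_rel.one_right)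
    with Inr \<open>b \<in> carrier B\<close> show ?thesis by auto
  qed
  then obtain y where y: "y \<in> carrier A <+> carrier B" "([y, x], []) \<in> rel" by blast
  have "w \<in> amalg_words A B" using Cons.prems by simp
  then have "([y, x] @ w, [] @ w) \<in> rel"
    using y(2) by (intro amalg_rel.append amalg_rel.refl)
  then have "(w' @ [y, x] @ w, w' @ w) \<in> rel"
    using amalg_rel.append[OF amalg_rel.refl[OF w'(1)]] by fastforce
  then have "((w' @ [y]) @ x # w, []) \<in> rel"
    using w'(2) by (auto intro: amalg_rel.trans)
  moreover have "w' @ [y] \<in> amalg_words A B" using w'(1) y(1) by simp
  ultimately show ?case by blast
qed

sublocale P: group P
proof (rule groupI)
  show "\<one>\<^bsub>P\<^esub> \<in> carrier P" by (auto simp: carrier_P one_P)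
  fix x assume "x \<in> carrier P"
  then obtain u where u: "u \<in> amalg_words A B" "x = cls u" by (auto simp: carrier_P)
  show "\<one>\<^bsub>P\<^esub> \<otimes>\<^bsub>P\<^esub> x = x" using u by (simp add: one_P mult_P)
  obtain u' where u': "u' \<in> amalg_words A B" "(u' @ u, []) \<in> rel"
    using left_inverse u(1) by blast
  have "cls (u' @ u) = cls []" using u' u(1) by (subst cls_eq_iff) auto
  then show "\<exists>y\<in>carrier P. y \<otimes>\<^bsub>P\<^esub> x = \<one>\<^bsub>P\<^esub>"
    using u u' by (auto simp: carrier_P one_P mult_P)
  fix y assume "y \<in> carrier P"
  then obtain v where v: "v \<in> amalg_words A B" "y = cls v" by (auto simp: carrier_P)
  show "x \<otimes>\<^bsub>P\<^esub> y \<in> carrier P"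
    unfolding u v mult_P[OF u(1) v(1)] carrier_P using u v by (intro imageI) simp
  fix z assume "z \<in> carrier P"
  then obtain w where w: "w \<in> amalg_words A B" "z = cls w" by (auto simp: carrier_P)
  have "u @ v \<in> amalg_words A B" "v @ w \<in> amalg_words A B" using u v w by auto
  then show "x \<otimes>\<^bsub>P\<^esub> y \<otimes>\<^bsub>P\<^esub> z = x \<otimes>\<^bsub>P\<^esub> (y \<otimes>\<^bsub>P\<^esub> z)"
    unfolding u v w using u v w by (simp add: mult_P del: append_in_lists_conv)
qed

definition "\<iota>\<^sub>A a = cls [Inl a]"
definition "\<iota>\<^sub>B b = cls [Inr b]"

lemma \<iota>\<^sub>A_hom: "\<iota>\<^sub>A \<in> hom A P"
proof (rule homI)
  fix a a' assume a: "a \<in> carrier A" "a' \<in> carrier A"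
  then show "\<iota>\<^sub>A a \<in> carrier P" by (auto simp: \<iota>\<^sub>A_def carrier_P)
  have "cls [Inl a, Inl a'] = cls [Inl (a \<otimes>\<^bsub>A\<^esub> a')]"
    using a by (subst cls_eq_iff) (auto intro: amalg_rel.mult_left)
  then show "\<iota>\<^sub>A (a \<otimes>\<^bsub>A\<^esub> a') = \<iota>\<^sub>A a \<otimes>\<^bsub>P\<^esub> \<iota>\<^sub>A a'"
    using a mult_P[of "[Inl a]" "[Inl a']"] by (auto simp: \<iota>\<^sub>A_def)
qed

lemma \<iota>\<^sub>B_hom: "\<iota>\<^sub>B \<in> hom B P"
proof (rule homI)
  fix b b' assume b: "b \<in> carrier B" "b' \<in> carrier B"
  then show "\<iota>\<^sub>B b \<in> carrier P" by (auto simp: \<iota>\<^sub>B_def carrier_P)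
  have "cls [Inr b, Inr b'] = cls [Inr (b \<otimes>\<^bsub>B\<^esub> b')]"
    using b by (subst cls_eq_iff) (auto intro: amalg_rel.mult_right)
  then show "\<iota>\<^sub>B (b \<otimes>\<^bsub>B\<^esub> b') = \<iota>\<^sub>B b \<otimes>\<^bsub>P\<^esub> \<iota>\<^sub>B b'"
    using b mult_P[of "[Inr b]" "[Inr b']"] by (auto simp: \<iota>\<^sub>B_def)
qed

lemma \<iota>_glue: "c \<in> carrier C \<Longrightarrow> \<iota>\<^sub>A (i c) = \<iota>\<^sub>B (j c)"
  unfolding \<iota>\<^sub>A_def \<iota>\<^sub>B_def by (subst cls_eq_iff) (auto intro: amalg_rel.glue)

theorem universal_property:
  assumes "group H" and f: "f \<in> hom A H" and g: "g \<in> hom B H"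
    and fg: "\<And>c. c \<in> carrier C \<Longrightarrow> f (i c) = g (j c)"
  shows "\<exists>h\<in>hom P H. (\<forall>a\<in>carrier A. h (\<iota>\<^sub>A a) = f a) \<and> (\<forall>b\<in>carrier B. h (\<iota>\<^sub>B b) = g b) \<and>
           (\<forall>h'\<in>hom P H. (\<forall>a\<in>carrier A. h' (\<iota>\<^sub>A a) = f a) \<and> (\<forall>b\<in>carrier B. h' (\<iota>\<^sub>B b) = g b)
              \<longrightarrow> (\<forall>x\<in>carrier P. h' x = h x))"
proof -
  interpret H: group H by fact
  interpret f: group_hom A H f by unfold_locales (rule f)
  interpret g: group_hom B H g by unfold_locales (rule g)
  define ev where "ev w = foldr (\<otimes>\<^bsub>H\<^esub>) (map (case_sum f g) w) \<one>\<^bsub>H\<^esub>" for w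
  have map_closed: "set (map (case_sum f g) w) \<subseteq> carrier H" if "w \<in> amalg_words A B" for w
    using that by (auto split: sum.splits)
  have ev_closed: "ev w \<in> carrier H" if "w \<in> amalg_words A B" for w
    unfolding ev_def by (rule H.foldr_closed[OF map_closed[OF that]])
  have ev_append: "ev (u @ v) = ev u \<otimes>\<^bsub>H\<^esub> ev v"
    if "u \<in> amalg_words A B" "v \<in> amalg_words A B" for u v
    unfolding ev_def map_append by (rule H.foldr_append[OF map_closed[OF that(1)] map_closed[OF that(2)]])
  have ev_rel: "(u, v) \<in> rel \<Longrightarrow> ev u = ev v" for u v
  proof (induction rule: amalg_rel.induct)
    case (append u u' v v')
    then show ?case using rel_words by (metis ev_append)
  qed (auto simp: ev_def fg)
  define h where "h K = ev (SOME w. w \<in> K)" for K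
  have h_cls: "h (cls w) = ev w" if "w \<in> amalg_words A B" for w
  proof -
    have "w \<in> cls w" using that by (auto intro: amalg_rel.refl)
    then have "(SOME w'. w' \<in> cls w) \<in> cls w" by (rule someI)
    then show ?thesis unfolding h_def using ev_rel by force
  qed
  have h_hom: "h \<in> hom P H"
  proof (rule homI)
    fix x y assume "x \<in> carrier P" "y \<in> carrier P"
    then obtain u v where uv: "u \<in> amalg_words A B" "x = cls u" "v \<in> amalg_words A B" "y = cls v"
      by (auto simp: carrier_P)
    show "h x \<in> carrier H" using uv by (simp add: h_cls ev_closed)
    have "u @ v \<in> amalg_words A B" using uv by simp
    then show "h (x \<otimes>\<^bsub>P\<^esub> y) = h x \<otimes>\<^bsub>H\<^esub> h y" using uv by (simp add: mult_P h_cls ev_append)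
  qed
  have uniq: "h' (cls w) = ev w"
    if "h' \<in> hom P H" "\<forall>a\<in>carrier A. h' (\<iota>\<^sub>A a) = f a" "\<forall>b\<in>carrier B. h' (\<iota>\<^sub>B b) = g b"
      "w \<in> amalg_words A B" for h' w
    using that(4)
  proof (induction w)
    case Nil
    show ?case using hom_one[OF that(1) P.group_axioms H.group_axioms] by (simp add: one_P ev_def)
  next
    case (Cons x w)
    then have w: "[x] \<in> amalg_words A B" "w \<in> amalg_words A B" by auto
    have x: "h' (cls [x]) = ev [x]"
      using w(1) that(2,3) by (cases x) (auto simp: ev_def \<iota>\<^sub>A_def \<iota>\<^sub>B_def)
    have "h' (cls (x # w)) = h' (cls [x] \<otimes>\<^bsub>P\<^esub> cls w)" using mult_P[OF w] by simp
    also have "\<dots> = h' (cls [x]) \<otimes>\<^bsub>H\<^esub> h' (cls w)"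
      using w by (intro hom_mult[OF that(1)]) (simp_all add: carrier_P del: Cons_in_lists_iff)
    also have "\<dots> = ev (x # w)" using ev_append[OF w] x Cons.IH by simp
    finally show ?case .
  qed
  show ?thesis
  proof (intro bexI[OF _ h_hom] conjI ballI impI)
    fix a assume "a \<in> carrier A"
    then show "h (\<iota>\<^sub>A a) = f a" using h_cls[of "[Inl a]"] by (auto simp: \<iota>\<^sub>A_def ev_def)
  next
    fix b assume "b \<in> carrier B"
    then show "h (\<iota>\<^sub>B b) = g b" using h_cls[of "[Inr b]"] by (auto simp: \<iota>\<^sub>B_def ev_def)
  next
    fix h' x
    assume h': "h' \<in> hom P H" and x: "x \<in> carrier P"
      and "(\<forall>a\<in>carrier A. h' (\<iota>\<^sub>A a) = f a) \<and> (\<forall>b\<in>carrier B. h' (\<iota>\<^sub>B b) = g b)"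
    then have "h' (cls w) = h (cls w)" if "w \<in> amalg_words A B" for w
      using uniq[OF h' _ _ that] h_cls[OF that] by presburger
    then show "h' x = h x" using x unfolding carrier_P by blast
  qed
qed

end

end

theory Submission
  imports Defs
begin

text \<open>
  The group \<open>G = A *\<^sub>C B\<close> acts on its Bass-Serre tree: the vertices are the cosets of \<open>A\<close> and of
  \<open>B\<close>, the edges are the cosets \<open>g C\<close>, and \<open>g C\<close> joins \<open>g A\<close> to \<open>g B\<close>. Multiplying on the right
  by a generator from \<open>A\<close> or \<open>B\<close> moves from an edge to one that shares a vertex with it, so a path
  in the Cayley graph is shadowed by a path in the tree. Trees have asymptotic dimension at most 1,
  and a part of \<open>G\<close> lying over a bounded part of the tree has dimension at most \<open>n\<close>; two families
  of \<open>n + 1\<close> colours each give the bound \<open>2 n + 1\<close>.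

  The proof uses one feature of the tree: an edge separates it. Hence a path of \<open>G\<close> that leaves the
  branch beyond an edge \<open>y C\<close> runs through the coset \<open>y C\<close>. The level of \<open>g\<close> is the distance in
  the tree from \<open>g C\<close> to the base edge \<open>C\<close>. Branches at distinct edges of the same level are
  disjoint (\<open>branch_unique\<close>), so two points that are close to each other and far from the
  elements of level \<open>m\<close> lie beyond the same edge of level \<open>m\<close> (\<open>ancestors_locally_constant\<close>).
  This is applied twice.

    \<^item> Bounded level (\<open>asdim_level_ball\<close>): away from the elements of level at most \<open>k\<close>, those of
      level \<open>k + 1\<close> fall into far apart pieces, each inside a coset of \<open>A\<close> or \<open>B\<close>. A union theorem
      (\<open>colourable_union\<close>) then carries dimension at most \<open>n\<close> from level \<open>k\<close> to level \<open>k + 1\<close>.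

    \<^item> All levels (\<open>asdim_split_group\<close>): cut \<open>G\<close> into annuli of \<open>q \<ge> r\<close> consecutive levels. Annuli
      of the same parity are far apart, and an annulus falls into far apart pieces, each a
      translate of a set of bounded level. The even annuli use \<open>n + 1\<close> colours and the odd ones
      another \<open>n + 1\<close>.

  Separation by the edge \<open>C\<close> is obtained without normal forms (\<open>half_space_exists\<close>): a bit that \<open>B\<close>
  preserves and that \<open>A\<close> flips on entering or leaving \<open>C\<close> defines actions of \<open>A\<close> and \<open>B\<close> that agree
  on \<open>C\<close>, hence an action of \<open>G\<close>, and the bit tells the two sides apart. A second action, on
  \<open>A \<times> B\<close>, shows that \<open>A\<close> and \<open>B\<close> embed in \<open>G\<close> (\<open>\<iota>_inj\<close>); finiteness of balls turns this into a
  comparison of the word metrics of \<open>A\<close> and \<open>B\<close> with that of \<open>G\<close>.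
\<close>

section \<open>Colourings with bounded chains\<close>

definition steps :: "('x \<Rightarrow> 'x \<Rightarrow> real) \<Rightarrow> real \<Rightarrow> 'x set \<Rightarrow> ('x \<Rightarrow> nat) \<Rightarrow> ('x \<times> 'x) set" where
  "steps d r X c = {(x, y). x \<in> X \<and> y \<in> X \<and> c x = c y \<and> d x y < r}"

text \<open>
  A cover by \<open>n + 1\<close> uniformly bounded \<open>r\<close>-disjoint families is the same as a colouring with
  \<open>n + 1\<close> colours whose monochromatic chains with steps shorter than \<open>r\<close> have bounded diameter:
  the members of the families are the chain components. Colourings are easier to pull back and to
  combine than families.
\<close>

definition colourable :: "('x \<Rightarrow> 'x \<Rightarrow> real) \<Rightarrow> nat \<Rightarrow> real \<Rightarrow> real \<Rightarrow> 'x set \<Rightarrow> bool" where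
  "colourable d n r D X \<longleftrightarrow>
     (\<exists>c. (\<forall>x\<in>X. c x \<le> n) \<and> (\<forall>x\<in>X. \<forall>y. (x, y) \<in> (steps d r X c)\<^sup>* \<longrightarrow> d x y \<le> D))"

definition asdim_at_most :: "('x \<Rightarrow> 'x \<Rightarrow> real) \<Rightarrow> nat \<Rightarrow> 'x set \<Rightarrow> bool" where
  "asdim_at_most d n X \<longleftrightarrow> (\<forall>r>0. \<exists>D. colourable d n r D X)"

lemma colourableI:
  assumes "\<And>x. x \<in> X \<Longrightarrow> c x \<le> n"
    and "\<And>x y. x \<in> X \<Longrightarrow> (x, y) \<in> (steps d r X c)\<^sup>* \<Longrightarrow> d x y \<le> D"
  shows "colourable d n r D X"
  using assms unfolding colourable_def by blast

lemma chain_in: "(x, y) \<in> (steps d r X c)\<^sup>* \<Longrightarrow> x \<in> X \<Longrightarrow> y \<in> X \<and> c y = c x"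
  by (induction rule: rtrancl_induct) (auto simp: steps_def)

text \<open>
  Only the two moduli of \<open>\<phi>\<close> matter, so this covers restriction, isometries, and changes of metric.
\<close>

lemma colourable_pullback:
  assumes col: "colourable d' n r' D' X'"
    and \<phi>: "\<And>x. x \<in> X \<Longrightarrow> \<phi> x \<in> X'"
    and near: "\<And>x y. x \<in> X \<Longrightarrow> y \<in> X \<Longrightarrow> d x y < r \<Longrightarrow> d' (\<phi> x) (\<phi> y) < r'"
    and bounded: "\<And>x y. x \<in> X \<Longrightarrow> y \<in> X \<Longrightarrow> d' (\<phi> x) (\<phi> y) \<le> D' \<Longrightarrow> d x y \<le> D"
  shows "colourable d n r D X"
proof -
  obtain c where c: "\<forall>x\<in>X'. c x \<le> n"
    "\<forall>x\<in>X'. \<forall>y. (x, y) \<in> (steps d' r' X' c)\<^sup>* \<longrightarrow> d' x y \<le> D'"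
    using col unfolding colourable_def by blast
  show ?thesis
  proof (rule colourableI[where c = "c \<circ> \<phi>"])
    fix x y assume x: "x \<in> X" and xy: "(x, y) \<in> (steps d r X (c \<circ> \<phi>))\<^sup>*"
    from xy have "(\<phi> x, \<phi> y) \<in> (steps d' r' X' c)\<^sup>*"
    proof (induction rule: rtrancl_induct)
      case (step y z)
      then have "(\<phi> y, \<phi> z) \<in> steps d' r' X' c"
        using \<phi> near by (auto simp: steps_def)
      with step.IH show ?case by (rule rtrancl_into_rtrancl)
    qed simp
    then show "d x y \<le> D"
      using c(2) \<phi> bounded x chain_in[OF xy x] by blast
  qed (use c(1) \<phi> in auto)
qed

lemma colourable_mono:
  assumes "colourable d n r' D' X'" "X \<subseteq> X'" "r \<le> r'" "D' \<le> D"
  shows "colourable d n r D X"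
  by (rule colourable_pullback[where \<phi> = "\<lambda>x. x", OF assms(1)]) (use assms in auto)

lemma asdim_at_most_subset: "asdim_at_most d n X \<Longrightarrow> Y \<subseteq> X \<Longrightarrow> asdim_at_most d n Y"
  unfolding asdim_at_most_def by (meson colourable_mono order_refl)

text \<open>
  A chain cannot leave a fibre of \<open>f\<close>, so the fibres are coloured independently of each other, with
  one bound \<open>D\<close> for all of them.
\<close>

lemma colourable_disjoint_union:
  assumes f: "\<And>x y. x \<in> X \<Longrightarrow> y \<in> X \<Longrightarrow> d x y < r \<Longrightarrow> f x = f y"
    and col: "\<And>a. colourable d n r D {x \<in> X. f x = a}"
  shows "colourable d n r D X"
proof -
  define Q where "Q a c \<longleftrightarrow> (\<forall>x\<in>{x \<in> X. f x = a}. c x \<le> n) \<and>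
    (\<forall>x\<in>{x \<in> X. f x = a}. \<forall>y. (x, y) \<in> (steps d r {x \<in> X. f x = a} c)\<^sup>* \<longrightarrow> d x y \<le> D)" for a c
  have "\<forall>a. \<exists>c. Q a c" using col unfolding colourable_def Q_def by blast
  then obtain c where "\<And>a. Q a (c a)" by metis
  then have c: "\<And>x. x \<in> X \<Longrightarrow> c (f x) x \<le> n"
    "\<And>x y. x \<in> X \<Longrightarrow> (x, y) \<in> (steps d r {z \<in> X. f z = f x} (c (f x)))\<^sup>* \<Longrightarrow> d x y \<le> D"
    unfolding Q_def by blast+
  show ?thesis
  proof (rule colourableI[where c = "\<lambda>x. c (f x) x"])
    fix x y assume x: "x \<in> X" and xy: "(x, y) \<in> (steps d r X (\<lambda>x. c (f x) x))\<^sup>*"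
    from xy have "f y = f x \<and> (x, y) \<in> (steps d r {z \<in> X. f z = f x} (c (f x)))\<^sup>*"
    proof (induction rule: rtrancl_induct)
      case (step y z)
      then have "f z = f y" using f[of y z] by (auto simp: steps_def)
      then have "(y, z) \<in> steps d r {z \<in> X. f z = f x} (c (f x))"
        using step by (auto simp: steps_def)
      with step.IH \<open>f z = f y\<close> show ?case by (metis (no_types, lifting) rtrancl_into_rtrancl)
    qed simp
    then show "d x y \<le> D" using c(2) x by blast
  qed (use c(1) in auto)
qed

text \<open>
  The parts use disjoint palettes, the even and the odd colours; \<open>n + 1\<close> of each make \<open>2 n + 2\<close>.
\<close>

lemma colourable_two_parts:
  assumes "colourable d n r D X" "colourable d n r D Y"
  shows "colourable d (2 * n + 1) r D (X \<union> Y)"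
proof -
  obtain c where c: "\<And>x. x \<in> X \<Longrightarrow> c x \<le> n"
    "\<And>x y. x \<in> X \<Longrightarrow> (x, y) \<in> (steps d r X c)\<^sup>* \<Longrightarrow> d x y \<le> D"
    using assms(1) unfolding colourable_def by blast
  obtain e where e: "\<And>x. x \<in> Y \<Longrightarrow> e x \<le> n"
    "\<And>x y. x \<in> Y \<Longrightarrow> (x, y) \<in> (steps d r Y e)\<^sup>* \<Longrightarrow> d x y \<le> D"
    using assms(2) unfolding colourable_def by blast
  let ?g = "\<lambda>x. if x \<in> X then 2 * c x else 2 * e x + 1"
  show ?thesis
  proof (rule colourableI[where c = ?g])
    fix x assume "x \<in> X \<union> Y"
    then show "?g x \<le> 2 * n + 1" using c(1)[of x] e(1)[of x] by auto
  next
    fix x y assume x: "x \<in> X \<union> Y" and xy: "(x, y) \<in> (steps d r (X \<union> Y) ?g)\<^sup>*"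
    show "d x y \<le> D"
    proof (cases "x \<in> X")
      case True
      from xy have "y \<in> X \<and> (x, y) \<in> (steps d r X c)\<^sup>*"
      proof (induction rule: rtrancl_induct)
        case (step y z)
        have yz: "z \<in> X \<union> Y" "?g y = ?g z" "d y z < r"
          using step.hyps by (auto simp: steps_def)
        then have "z \<in> X"
          using step.IH double_not_eq_Suc_double[of "c y" "e z"] double_not_eq_Suc_double[of "c z" "e y"]
          by (auto split: if_splits)
        moreover have "(y, z) \<in> steps d r X c"
          using yz step.IH calculation by (auto simp: steps_def)
        ultimately have "z \<in> X" "(y, z) \<in> steps d r X c" by blast+
        with step.IH show ?case by (meson rtrancl_into_rtrancl)
      qed (use True in simp)
      then show ?thesis using c(2) True by blast
    next
      case False
      from xy have "y \<in> Y - X \<and> (x, y) \<in> (steps d r Y e)\<^sup>*"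
      proof (induction rule: rtrancl_induct)
        case (step y z)
        have yz: "z \<in> X \<union> Y" "?g y = ?g z" "d y z < r"
          using step.hyps by (auto simp: steps_def)
        then have "z \<in> Y - X"
          using step.IH double_not_eq_Suc_double[of "c y" "e z"] double_not_eq_Suc_double[of "c z" "e y"]
          by (auto split: if_splits)
        moreover have "(y, z) \<in> steps d r Y e"
          using yz step.IH calculation by (auto simp: steps_def)
        ultimately have "z \<in> Y - X" "(y, z) \<in> steps d r Y e" by blast+
        with step.IH show ?case by (meson rtrancl_into_rtrancl)
      qed (use False x in simp)
      then show ?thesis using e(2) False x by blast
    qed
  qed
qed

context Metric_space
begin

lemma steps_sym: "(x, y) \<in> (steps d r X c)\<^sup>* \<Longrightarrow> (y, x) \<in> (steps d r X c)\<^sup>*"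
proof -
  have "sym (steps d r X c)" by (auto simp: sym_def steps_def commute)
  then show "(x, y) \<in> (steps d r X c)\<^sup>* \<Longrightarrow> (y, x) \<in> (steps d r X c)\<^sup>*"
    using sym_rtrancl by (metis symD)
qed

text \<open>
  No new colours are needed if \<open>Y\<close> is coloured at a scale that exceeds the diameter of the chains
  of \<open>Z\<close>: a chain in the union visits \<open>Y\<close> at points that are separated by excursions into \<open>Z\<close> of
  diameter at most \<open>R\<close>, so consecutive visits are less than \<open>R + 2 r\<close> apart and form a chain of \<open>Y\<close>.
\<close>

lemma colourable_union:
  assumes Z: "colourable d n r R Z" and Y: "colourable d n (R + 2 * r) D Y"
    and sub: "Y \<subseteq> M" "Z \<subseteq> M" and "r > 0" "R \<ge> 0" "D \<ge> 0"
  shows "colourable d n r (D + 2 * (R + r)) (Y \<union> Z)"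
proof -
  define Z' where "Z' = Z - Y"
  have "colourable d n r R Z'" using Z by (rule colourable_mono) (auto simp: Z'_def)
  then obtain cz where cz: "\<And>x. x \<in> Z' \<Longrightarrow> cz x \<le> n"
    "\<And>x y. x \<in> Z' \<Longrightarrow> (x, y) \<in> (steps d r Z' cz)\<^sup>* \<Longrightarrow> d x y \<le> R"
    unfolding colourable_def by blast
  obtain cy where cy: "\<And>x. x \<in> Y \<Longrightarrow> cy x \<le> n"
    "\<And>x y. x \<in> Y \<Longrightarrow> (x, y) \<in> (steps d (R + 2 * r) Y cy)\<^sup>* \<Longrightarrow> d x y \<le> D"
    using Y unfolding colourable_def by blast
  define c where "c x = (if x \<in> Y then cy x else cz x)" for x
  have Z'M: "Z' \<subseteq> M" using sub by (auto simp: Z'_def)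
  have U: "Y \<union> Z = Y \<union> Z'" by (auto simp: Z'_def)
  have disj: "\<And>x. x \<in> Z' \<Longrightarrow> x \<notin> Y" by (auto simp: Z'_def)
  let ?cz = "(steps d r Z' cz)\<^sup>*" and ?cy = "(steps d (R + 2 * r) Y cy)\<^sup>*"
  show ?thesis unfolding U
  proof (rule colourableI[where c = c])
    fix x assume "x \<in> Y \<union> Z'"
    then show "c x \<le> n" using cy(1) cz(1) by (auto simp: c_def)
  next
    fix x y assume x: "x \<in> Y \<union> Z'" and xy: "(x, y) \<in> (steps d r (Y \<union> Z') c)\<^sup>*"
    \<comment> \<open>Either the chain has not met \<open>Y\<close> yet, or \<open>u\<close> and \<open>v\<close> are its first and its most recent point
      in \<open>Y\<close>, and \<open>z\<close> is where the current excursion into \<open>Z'\<close> started.\<close>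
    from xy have "(x \<in> Z' \<and> (x, y) \<in> ?cz) \<or>
      (\<exists>u v. u \<in> Y \<and> v \<in> Y \<and> d x u \<le> R + r \<and> (u, v) \<in> ?cy \<and> c v = c x \<and>
         (y = v \<or> (\<exists>z. z \<in> Z' \<and> d v z < r \<and> (z, y) \<in> ?cz \<and> c z = c x)))"
      (is "?start y \<or> (\<exists>u v. ?pass u v y)")
    proof (induction rule: rtrancl_induct)
      case base
      have "x \<in> Y \<Longrightarrow> ?pass x x x"
        using sub \<open>r > 0\<close> \<open>R \<ge> 0\<close> by (auto simp: subset_iff)
      then show ?case using x by blast
    next
      case (step y w)
      have yw: "y \<in> Y \<union> Z'" "w \<in> Y \<union> Z'" "c y = c w" "d y w < r"
        using step.hyps(2) by (auto simp: steps_def)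
      have cyx: "c y = c x" using chain_in[OF step.hyps(1) x] by simp
      have M: "x \<in> M" "y \<in> M" "w \<in> M" using yw x sub Z'M by auto
      from step.IH consider (start) "?start y" | (pass) u v where "?pass u v y" by blast
      then show ?case
      proof cases
        case start
        then have y: "y \<in> Z'" using chain_in[of x y d r Z' cz] by simp
        show ?thesis
        proof (cases "w \<in> Y")
          case True
          have "d x w \<le> R + r"
            using triangle[OF M] cz(2)[of x y] start yw(4) by auto
          then have "?pass w w w" using True yw(3) cyx by auto
          then show ?thesis by blast
        next
          case False
          then have "(y, w) \<in> steps d r Z' cz" using y yw disj by (auto simp: steps_def c_def)
          then show ?thesis using start by (meson rtrancl_into_rtrancl)
        qed
      next
        case pass
        note p = pass
        have vM: "v \<in> M" using p sub by auto
        show ?thesis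
        proof (cases "w \<in> Y")
          case True
          have "d v w < R + 2 * r"
          proof (cases "y = v")
            case True
            then show ?thesis using yw(4) \<open>r > 0\<close> \<open>R \<ge> 0\<close> by auto
          next
            case False
            then obtain z where z: "z \<in> Z'" "d v z < r" "(z, y) \<in> ?cz" using p by blast
            then have "d z y \<le> R" using cz(2) by blast
            moreover have "z \<in> M" using z Z'M by auto
            ultimately show ?thesis
              using triangle[of v z w] triangle[of z y w] z(2) yw(4) vM M by auto
          qed
          then have "(v, w) \<in> steps d (R + 2 * r) Y cy"
            using p True yw(3) cyx by (auto simp: steps_def c_def)
          then have "(u, w) \<in> ?cy" using p rtrancl_into_rtrancl[of u v _ w] by blast
          then have "?pass u w w" using p True yw(3) cyx by simp
          then show ?thesis by blast
        next
          case False
          then have w: "w \<in> Z'" using yw by blast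
          show ?thesis
          proof (cases "y = v")
            case True
            then have "?pass u v w" using p w yw(3,4) cyx by (auto intro!: exI[of _ w])
            then show ?thesis by blast
          next
            case False
            then obtain z where z: "z \<in> Z'" "d v z < r" "(z, y) \<in> ?cz" "c z = c x" using p by blast
            then have "y \<in> Z'" using chain_in[OF z(3) z(1)] by blast
            then have "(y, w) \<in> steps d r Z' cz" using w yw disj by (auto simp: steps_def c_def)
            with z(3) have "(z, w) \<in> ?cz" by (rule rtrancl_into_rtrancl)
            then have "?pass u v w" using p z(1,2,4) by blast
            then show ?thesis by blast
          qed
        qed
      qed
    qed
    then show "d x y \<le> D + 2 * (R + r)"
    proof
      assume "?start y"
      then show ?thesis using cz(2)[of x y] \<open>r > 0\<close> \<open>R \<ge> 0\<close> \<open>D \<ge> 0\<close> by auto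
    next
      assume "\<exists>u v. ?pass u v y"
      then obtain u v where p: "?pass u v y" by blast
      then have uv: "d u v \<le> D" "u \<in> M" "v \<in> M" using cy(2) sub by auto
      have M: "x \<in> M" "y \<in> M" using x chain_in[OF xy x] sub Z'M by auto
      have "d v y \<le> R + r"
      proof (cases "y = v")
        case True
        then show ?thesis using uv(3) \<open>r > 0\<close> \<open>R \<ge> 0\<close> by auto
      next
        case False
        then obtain z where z: "z \<in> Z'" "d v z < r" "(z, y) \<in> ?cz" using p by blast
        then have "d z y \<le> R" "z \<in> M" using cz(2) Z'M by auto
        then show ?thesis using triangle[of v z y] z(2) uv M by auto
      qed
      then show ?thesis
        using triangle[of x u y] triangle[of u v y] p uv M by auto
    qed
  qed
qed

lemma asdim_le_iff_asdim_at_most: "asdim_le n \<longleftrightarrow> asdim_at_most d n M"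
  unfolding asdim_at_most_def
proof (intro iffI allI impI)
  fix r :: real assume "asdim_le n" "r > 0"
  then have "\<exists>\<F>. (\<forall>i\<le>n. (\<forall>U\<in>\<F> i. U \<subseteq> M) \<and> uniformly_bounded (\<F> i) \<and>
      disjoint_family_at_scale r (\<F> i)) \<and> M \<subseteq> (\<Union>i\<le>n. \<Union>(\<F> i))"
    unfolding asdim_le_def by blast
  then obtain \<F> where "(\<forall>i\<le>n. (\<forall>U\<in>\<F> i. U \<subseteq> M) \<and> uniformly_bounded (\<F> i) \<and>
      disjoint_family_at_scale r (\<F> i)) \<and> M \<subseteq> (\<Union>i\<le>n. \<Union>(\<F> i))"
    by (rule exE)
  then have F: "\<And>i. i \<le> n \<Longrightarrow> uniformly_bounded (\<F> i)"
    "\<And>i. i \<le> n \<Longrightarrow> disjoint_family_at_scale r (\<F> i)" "M \<subseteq> (\<Union>i\<le>n. \<Union>(\<F> i))"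
    by simp_all
  have "\<forall>i. \<exists>D. i \<le> n \<longrightarrow> (\<forall>U\<in>\<F> i. \<forall>x\<in>U. \<forall>y\<in>U. d x y \<le> D)"
    using F(1) unfolding uniformly_bounded_def by blast
  from choice[OF this] obtain b where
    b: "\<And>i U x y. i \<le> n \<Longrightarrow> U \<in> \<F> i \<Longrightarrow> x \<in> U \<Longrightarrow> y \<in> U \<Longrightarrow> d x y \<le> b i"
    by blast
  have "\<forall>x\<in>M. \<exists>i. i \<le> n \<and> x \<in> \<Union>(\<F> i)" using F(3) by blast
  then obtain c where c: "\<And>x. x \<in> M \<Longrightarrow> c x \<le> n \<and> x \<in> \<Union>(\<F> (c x))" by metis
  have "colourable d n r (Max (b ` {..n})) M"
  proof (rule colourableI[where c = c])
    fix x y assume x: "x \<in> M" and xy: "(x, y) \<in> (steps d r M c)\<^sup>*"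
    obtain U where U: "U \<in> \<F> (c x)" "x \<in> U" using c[OF x] by blast
    from xy have "c y = c x \<and> y \<in> U"
    proof (induction rule: rtrancl_induct)
      case (step y z)
      then have yz: "z \<in> M" "c z = c x" "d y z < r" "y \<in> U" by (auto simp: steps_def)
      then obtain V where V: "V \<in> \<F> (c x)" "z \<in> V" using c[of z] by auto
      have "U = V"
      proof (rule ccontr)
        assume "U \<noteq> V"
        then have "disjoint_at_scale r U V"
          using F(2)[of "c x"] c[OF x] U V by (auto simp: disjoint_family_at_scale_def pairwise_def)
        then show False using yz V by (force simp: disjoint_at_scale_iff)
      qed
      then show ?case using V yz by simp
    qed (use U in simp)
    then have "d x y \<le> b (c x)" using b U c[OF x] by blast
    also have "\<dots> \<le> Max (b ` {..n})" using c[OF x] by (intro Max_ge) auto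
    finally show "d x y \<le> Max (b ` {..n})" .
  qed (use c in blast)
  then show "\<exists>D. colourable d n r D M" ..
next
  assume col: "\<forall>r>0. \<exists>D. colourable d n r D M"
  show "asdim_le n" unfolding asdim_le_def
  proof (intro allI impI)
    fix r :: real assume "r > 0"
    then obtain D where "colourable d n r D M" using col by blast
    then obtain c where c: "\<And>x. x \<in> M \<Longrightarrow> c x \<le> n"
      "\<And>x y. x \<in> M \<Longrightarrow> (x, y) \<in> (steps d r M c)\<^sup>* \<Longrightarrow> d x y \<le> D"
      unfolding colourable_def by blast
    define comp where "comp x = {y. (x, y) \<in> (steps d r M c)\<^sup>*}" for x
    define \<F> where "\<F> i = comp ` {x \<in> M. c x = i}" for i
    have compM: "x \<in> M \<Longrightarrow> y \<in> comp x \<Longrightarrow> y \<in> M \<and> c y = c x" for x y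
      using chain_in[of x y d r M c] by (simp add: comp_def)
    have comp_sub: "comp y \<subseteq> comp x" if "y \<in> comp x" for x y
      using that rtrancl_trans[of x y "steps d r M c"] by (auto simp: comp_def)
    have comp_eq: "y \<in> comp x \<Longrightarrow> comp y = comp x" for x y
      using comp_sub[of y x] comp_sub[of x y] steps_sym[of x y r M c] by (simp add: comp_def)
    have member: "x \<in> M \<and> c x = i \<and> U = comp x" if "U \<in> \<F> i" "x \<in> U" for x U i
    proof -
      from that(1) obtain z where "z \<in> M" "c z = i" "U = comp z" unfolding \<F>_def by blast
      then show ?thesis using compM[of z x] comp_eq[of x z] that(2) by simp
    qed
    have "M \<subseteq> (\<Union>i\<le>n. \<Union>(\<F> i))"
    proof
      fix x assume "x \<in> M"
      moreover have "x \<in> comp x" by (simp add: comp_def)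
      ultimately show "x \<in> (\<Union>i\<le>n. \<Union>(\<F> i))" using c(1) by (auto simp: \<F>_def)
    qed
    moreover have "uniformly_bounded (\<F> i)" for i
      unfolding uniformly_bounded_def
    proof (intro exI ballI)
      fix U x y assume "U \<in> \<F> i" "x \<in> U" "y \<in> U"
      then have "x \<in> M" "y \<in> comp x" using member by blast+
      then show "d x y \<le> D" using c(2) by (simp add: comp_def)
    qed
    moreover have "disjoint_family_at_scale r (\<F> i)" for i
      unfolding disjoint_family_at_scale_def
    proof (rule pairwiseI)
      fix U V assume UV: "U \<in> \<F> i" "V \<in> \<F> i" "U \<noteq> V"
      show "disjoint_at_scale r U V" unfolding disjoint_at_scale_iff
      proof (intro ballI, rule ccontr)
        fix x y assume xy: "x \<in> U" "y \<in> V" "\<not> r \<le> d x y"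
        have x: "x \<in> M" "c x = i" "U = comp x" using member[OF UV(1) xy(1)] by auto
        have y: "y \<in> M" "c y = i" "V = comp y" using member[OF UV(2) xy(2)] by auto
        have "(x, y) \<in> steps d r M c" using x y xy(3) by (simp add: steps_def)
        then have "y \<in> comp x" by (auto simp: comp_def)
        then show False using comp_eq[of y x] x(3) y(3) UV(3) by simp
      qed
    qed
    moreover have "\<forall>U\<in>\<F> i. U \<subseteq> M" for i using member by blast
    ultimately show "\<exists>\<F>. (\<forall>i\<le>n. (\<forall>U\<in>\<F> i. U \<subseteq> M) \<and> uniformly_bounded (\<F> i) \<and>
        disjoint_family_at_scale r (\<F> i)) \<and> M \<subseteq> (\<Union>i\<le>n. \<Union>(\<F> i))"
      by (intro exI[of _ \<F>]) simp
  qed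
qed

end

section \<open>Word metrics\<close>

context group
begin

lemma letters_closed: "finite_generating_set G S \<Longrightarrow> S \<union> m_inv G ` S \<subseteq> carrier G"
  by (auto simp: finite_generating_set_def)

lemma word_dist_left_invariant:
  assumes "g \<in> carrier G" "x \<in> carrier G" "y \<in> carrier G"
  shows "word_dist G S (g \<otimes> x) (g \<otimes> y) = word_dist G S x y"
proof -
  have "inv g \<otimes> (g \<otimes> y) = y" using assms by (simp flip: m_assoc)
  then have "inv (g \<otimes> x) \<otimes> (g \<otimes> y) = inv x \<otimes> y"
    using assms by (simp add: inv_mult_group m_assoc)
  then show ?thesis using assms by (simp add: word_dist_def)
qed

lemma word_dist_word_le:
  assumes "finite_generating_set G S" "p \<in> carrier G" "set ws \<subseteq> S \<union> m_inv G ` S"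
  shows "word_dist G S p (p \<otimes> foldr (\<otimes>) ws \<one>) \<le> length ws"
proof -
  have "set ws \<subseteq> carrier G" using letters_closed assms by blast
  then have "foldr (\<otimes>) ws \<one> \<in> carrier G" by (rule foldr_closed)
  then show ?thesis
    using word_length_le[OF assms(3) HOL.refl] assms(2) by (simp add: word_dist_def flip: m_assoc)
qed

lemma word_dist_path:
  assumes "finite_generating_set G S" "p \<in> carrier G" "q \<in> carrier G"
  obtains ws where "set ws \<subseteq> S \<union> m_inv G ` S" "real (length ws) = word_dist G S p q"
    "q = p \<otimes> foldr (\<otimes>) ws \<one>"
proof -
  obtain ws where ws: "set ws \<subseteq> S \<union> m_inv G ` S" "length ws = word_length G S (inv p \<otimes> q)"
    "foldr (\<otimes>) ws \<one> = inv p \<otimes> q"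
    using word_length_witness[OF assms(1), of "inv p \<otimes> q"] assms
    by (metis inv_closed m_closed)
  have "p \<otimes> foldr (\<otimes>) ws \<one> = q" unfolding ws(3) using assms by (simp flip: m_assoc)
  moreover have "real (length ws) = word_dist G S p q" using ws(2) assms by (simp add: word_dist_def)
  ultimately show thesis using ws(1) that by blast
qed

lemma foldr_snoc:
  assumes "finite_generating_set G S" "p \<in> carrier G" "set (ws @ [s]) \<subseteq> S \<union> m_inv G ` S"
  shows "p \<otimes> foldr (\<otimes>) (ws @ [s]) \<one> = (p \<otimes> foldr (\<otimes>) ws \<one>) \<otimes> s"
proof -
  have "set (ws @ [s]) \<subseteq> carrier G" using letters_closed[OF assms(1)] assms(3) by (rule subset_trans[rotated])
  then have c: "set ws \<subseteq> carrier G" "s \<in> carrier G" by auto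
  then have "foldr (\<otimes>) (ws @ [s]) \<one> = foldr (\<otimes>) ws \<one> \<otimes> s"
    using foldr_append[of ws "[s]"] by (simp del: List.foldr_append)
  then show ?thesis using c assms(2) foldr_closed[OF c(1)] by (simp add: m_assoc del: List.foldr_append)
qed

text \<open>
  This is how separation is used metrically: a geodesic word from \<open>g\<close> to \<open>h\<close> can leave \<open>Q\<close> only
  through \<open>E\<close>, which is too far away for a word shorter than \<open>r\<close>.
\<close>

lemma stay_inside:
  assumes S: "finite_generating_set G S" and Q: "Q \<subseteq> carrier G"
    and exit: "\<And>p s. p \<in> Q \<Longrightarrow> s \<in> S \<union> m_inv G ` S \<Longrightarrow> p \<otimes> s \<in> Q \<union> E"
    and far: "\<And>e. e \<in> E \<Longrightarrow> r \<le> word_dist G S g e"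
    and g: "g \<in> Q" and h: "h \<in> carrier G" "word_dist G S g h < r"
  shows "h \<in> Q"
proof -
  have gc: "g \<in> carrier G" using g Q by blast
  obtain ws where ws: "set ws \<subseteq> S \<union> m_inv G ` S" "real (length ws) = word_dist G S g h"
    "h = g \<otimes> foldr (\<otimes>) ws \<one>"
    using word_dist_path[OF S gc h(1)] by blast
  have "set us \<subseteq> S \<union> m_inv G ` S \<Longrightarrow> length us < r \<Longrightarrow> g \<otimes> foldr (\<otimes>) us \<one> \<in> Q" for us
  proof (induction us rule: rev_induct)
    case Nil
    then show ?case using g gc by simp
  next
    case (snoc s us)
    let ?p = "g \<otimes> foldr (\<otimes>) (us @ [s]) \<one>"
    have "g \<otimes> foldr (\<otimes>) us \<one> \<in> Q" using snoc by auto
    then have "?p \<in> Q \<union> E"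
      unfolding foldr_snoc[OF S gc snoc.prems(1)] by (rule exit) (use snoc.prems in auto)
    moreover have "word_dist G S g ?p < r"
      using word_dist_word_le[OF S gc snoc.prems(1)] snoc.prems(2) by linarith
    ultimately show ?case using far by force
  qed
  then show ?thesis using ws h(2) by simp
qed

lemma lipschitz_along_letters:
  fixes f :: "'a \<Rightarrow> nat"
  assumes S: "finite_generating_set G S" and g: "g \<in> carrier G" "h \<in> carrier G"
    and step: "\<And>p s. p \<in> carrier G \<Longrightarrow> s \<in> S \<union> m_inv G ` S \<Longrightarrow> f (p \<otimes> s) \<le> f p + 1"
  shows "f h \<le> f g + word_dist G S g h"
proof -
  obtain ws where ws: "set ws \<subseteq> S \<union> m_inv G ` S" "real (length ws) = word_dist G S g h"
    "h = g \<otimes> foldr (\<otimes>) ws \<one>"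
    using word_dist_path[OF S g] by blast
  have "set us \<subseteq> S \<union> m_inv G ` S \<Longrightarrow> f (g \<otimes> foldr (\<otimes>) us \<one>) \<le> f g + length us" for us
  proof (induction us rule: rev_induct)
    case (snoc s us)
    have "set (us @ [s]) \<subseteq> carrier G" using letters_closed[OF S] snoc.prems by (rule subset_trans[rotated])
    then have "set us \<subseteq> carrier G" by simp
    then have "g \<otimes> foldr (\<otimes>) us \<one> \<in> carrier G" using g foldr_closed by simp
    then have "f (g \<otimes> foldr (\<otimes>) us \<one> \<otimes> s) \<le> f (g \<otimes> foldr (\<otimes>) us \<one>) + 1"
      by (rule step) (use snoc.prems in auto)
    then show ?case unfolding foldr_snoc[OF S g(1) snoc.prems] using snoc by simp
  qed (use g in simp)
  from this[OF ws(1)] show ?thesis using ws(2,3) by simp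
qed

lemma finite_word_ball:
  assumes S: "finite_generating_set G S"
  shows "finite {x \<in> carrier G. word_length G S x \<le> k}"
proof (rule finite_subset)
  let ?L = "{ws. set ws \<subseteq> S \<union> m_inv G ` S \<and> length ws \<le> k}"
  show "{x \<in> carrier G. word_length G S x \<le> k} \<subseteq> (\<lambda>ws. foldr (\<otimes>) ws \<one>) ` ?L"
  proof
    fix x assume x: "x \<in> {x \<in> carrier G. word_length G S x \<le> k}"
    then have "x \<in> carrier G" by simp
    then obtain ws where ws: "set ws \<subseteq> S \<union> m_inv G ` S" "length ws = word_length G S x"
      "foldr (\<otimes>) ws \<one> = x"
      using word_length_witness[OF S] by metis
    then have "ws \<in> ?L" using x by simp
    then show "x \<in> (\<lambda>ws. foldr (\<otimes>) ws \<one>) ` ?L"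
      by (rule image_eqI[of _ _ ws, rotated]) (simp add: ws(3))
  qed
  show "finite ((\<lambda>ws. foldr (\<otimes>) ws \<one>) ` ?L)"
    using S by (intro finite_imageI finite_lists_length_le) (simp add: finite_generating_set_def)
qed

end

lemma hom_word_length_le:
  assumes A: "group A" and G: "group G" and h: "h \<in> hom A G"
    and S: "finite_generating_set A S" and T: "finite_generating_set G T"
  obtains K where "\<And>x. x \<in> carrier A \<Longrightarrow> word_length G T (h x) \<le> K * word_length A S x"
proof -
  interpret A: group A by fact
  interpret G: group G by fact
  interpret h: group_hom A G h by unfold_locales (rule h)
  let ?L = "S \<union> m_inv A ` S"
  define K where "K = Max (insert 0 ((\<lambda>s. word_length G T (h s)) ` ?L))"
  have fin: "finite ?L" using S by (simp add: finite_generating_set_def)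
  have K: "word_length G T (h s) \<le> K" if "s \<in> ?L" for s
    unfolding K_def using fin that by (intro Max_ge) auto
  have *: "set ws \<subseteq> ?L \<Longrightarrow> word_length G T (h (foldr (\<otimes>\<^bsub>A\<^esub>) ws \<one>\<^bsub>A\<^esub>)) \<le> K * length ws" for ws
  proof (induction ws)
    case Nil
    then show ?case using G.word_length_eq_0[OF T, of "\<one>\<^bsub>G\<^esub>"] by simp
  next
    case (Cons s ws)
    then have c: "s \<in> carrier A" "set ws \<subseteq> carrier A" using A.letters_closed[OF S] by auto
    have "word_length G T (h (foldr (\<otimes>\<^bsub>A\<^esub>) (s # ws) \<one>\<^bsub>A\<^esub>))
        \<le> word_length G T (h s) + word_length G T (h (foldr (\<otimes>\<^bsub>A\<^esub>) ws \<one>\<^bsub>A\<^esub>))"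
      using c A.foldr_closed[OF c(2)] G.word_length_mult[OF T] by simp
    also have "\<dots> \<le> K + K * length ws" using K[of s] Cons by (intro add_mono) auto
    finally show ?case by simp
  qed
  show thesis
  proof (rule that)
    fix x assume "x \<in> carrier A"
    then obtain ws where "set ws \<subseteq> ?L" "length ws = word_length A S x"
      "foldr (\<otimes>\<^bsub>A\<^esub>) ws \<one>\<^bsub>A\<^esub> = x"
      using A.word_length_witness[OF S] by metis
    then show "word_length G T (h x) \<le> K * word_length A S x" using *[of ws] by simp
  qed
qed

text \<open>
  An injective homomorphism need not be a quasi-isometric embedding. It is still a coarse one:
  the preimage \<open>V\<close> of a ball is finite because balls are finite, so \<open>word_length A S\<close> is bounded by
  some \<open>N\<close> on it. With the identity for \<open>h\<close> this is independence of the generating set.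
\<close>

lemma asdim_at_most_hom_image:
  assumes A: "group A" and G: "group G" and h: "h \<in> hom A G" and inj: "inj_on h (carrier A)"
    and S: "finite_generating_set A S" and T: "finite_generating_set G T"
    and dim: "asdim_at_most (word_dist A S) n (carrier A)"
  shows "asdim_at_most (word_dist G T) n (h ` carrier A)"
  unfolding asdim_at_most_def
proof (intro allI impI)
  fix r :: real assume "r > 0"
  interpret A: group A by fact
  interpret G: group G by fact
  interpret h: group_hom A G h by unfold_locales (rule h)
  have dist: "word_dist G T (h x) (h y) = word_length G T (h (inv\<^bsub>A\<^esub> x \<otimes>\<^bsub>A\<^esub> y))"
    if "x \<in> carrier A" "y \<in> carrier A" for x y
    using that by (simp add: word_dist_def)
  obtain K where K: "\<And>x. x \<in> carrier A \<Longrightarrow> word_length G T (h x) \<le> K * word_length A S x"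
    using hom_word_length_le[OF A G h S T] by blast
  define V where "V = {x \<in> carrier A. word_length G T (h x) \<le> nat \<lceil>r\<rceil>}"
  have "finite (h ` V)"
    by (rule finite_subset[OF _ G.finite_word_ball[OF T, of "nat \<lceil>r\<rceil>"]]) (auto simp: V_def)
  moreover have "inj_on h V" using inj by (rule inj_on_subset) (auto simp: V_def)
  ultimately have "finite V" by (simp add: finite_image_iff)
  define N where "N = Max (word_length A S ` V)"
  have N: "word_length A S x \<le> N" if "x \<in> V" for x
    unfolding N_def using \<open>finite V\<close> that by (intro Max_ge) auto
  obtain D where D: "colourable (word_dist A S) n (real N + 1) D (carrier A)"
    using dim unfolding asdim_at_most_def by (meson of_nat_0_le_iff add_nonneg_pos zero_less_one)
  let ?\<phi> = "inv_into (carrier A) h"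
  have "colourable (word_dist G T) n r (K * D) (h ` carrier A)"
  proof (rule colourable_pullback[where \<phi> = ?\<phi>, OF D])
    fix x y assume "x \<in> h ` carrier A" "y \<in> h ` carrier A"
    then obtain a b where ab: "a \<in> carrier A" "x = h a" "b \<in> carrier A" "y = h b" by blast
    then have \<phi>: "?\<phi> x = a" "?\<phi> y = b" using inj by simp_all
    let ?c = "inv\<^bsub>A\<^esub> a \<otimes>\<^bsub>A\<^esub> b"
    have c: "?c \<in> carrier A" using ab by simp
    {
      assume "word_dist G T x y < r"
      then have "?c \<in> V" using ab c dist[of a b] by (simp add: V_def) linarith
      then show "word_dist A S (?\<phi> x) (?\<phi> y) < real N + 1"
        using N[of ?c] ab \<phi> by (simp add: word_dist_def)
    next
      assume "word_dist A S (?\<phi> x) (?\<phi> y) \<le> D"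
      then have "real (word_length A S ?c) \<le> D" using ab \<phi> by (simp add: word_dist_def)
      moreover have "real (word_length G T (h ?c)) \<le> real K * real (word_length A S ?c)"
        using K[OF c] by (metis of_nat_le_iff of_nat_mult)
      ultimately show "word_dist G T x y \<le> K * D"
        using ab dist[of a b] by (smt (verit) mult_left_mono of_nat_0_le_iff)
    }
  qed (auto simp: inv_into_into)
  then show "\<exists>D. colourable (word_dist G T) n r D (h ` carrier A)" ..
qed

section \<open>Half-spaces of a splitting\<close>

text \<open>
  The combinatorial content of an amalgam with factors \<open>F True\<close>, \<open>F False\<close> and edge group \<open>C\<close>.
  The factors are indexed by \<^typ>\<open>bool\<close> so that each argument covers both of them. The edge \<open>C\<close>
  of the tree joins the vertices \<open>F True\<close> and \<open>F False\<close>, and \<open>H t\<close> consists of the elements \<open>h\<close>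
  whose edge \<open>h C\<close> lies on the same side of \<open>C\<close> as the vertex \<open>F t\<close>. Assumptions \<open>cross\<close> and
  \<open>keep\<close> say that one step of a path leaves \<open>H t\<close> only onto the edge \<open>C\<close>, and only through the
  vertex \<open>F t\<close>.
\<close>

locale splitting = group G for G (structure) +
  fixes F :: "bool \<Rightarrow> 'a set" and C :: "'a set" and H :: "bool \<Rightarrow> 'a set"
  assumes F: "subgroup (F t) G" and C: "subgroup C G" and CF: "C \<subseteq> F t"
    and gen: "generate G (F True \<union> F False) = carrier G"
    and cover: "carrier G = C \<union> H t \<union> H (\<not> t)"
    and sides: "H t \<inter> H (\<not> t) = {}" and C_side: "C \<inter> H t = {}"
    and cross: "h \<in> H t \<Longrightarrow> f \<in> F t \<Longrightarrow> h \<otimes> f \<in> H t \<union> C"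
    and keep: "h \<in> H t \<Longrightarrow> f \<in> F (\<not> t) \<Longrightarrow> h \<otimes> f \<in> H t"
    and first: "f \<in> F t \<Longrightarrow> f \<notin> C \<Longrightarrow> f \<in> H t"
begin

lemma H_closed: "h \<in> H t \<Longrightarrow> h \<in> carrier G" using cover[of t] by blast

lemma F_closed: "f \<in> F t \<Longrightarrow> f \<in> carrier G" by (rule subgroup.mem_carrier[OF F])
lemma C_closed: "c \<in> C \<Longrightarrow> c \<in> carrier G" by (rule subgroup.mem_carrier[OF C])
lemmas closed = H_closed F_closed C_closed

lemma not_side: "x \<in> carrier G \<Longrightarrow> x \<notin> H t \<longleftrightarrow> x \<in> C \<union> H (\<not> t)"
  using cover[of t] sides[of t] C_side[of t] by blast

lemma one_not_side: "\<one> \<notin> H t"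
  using C_side[of t] subgroup.one_closed[OF C] by blast

lemma F_mult: "f \<in> F t \<Longrightarrow> g \<in> F t \<Longrightarrow> f \<otimes> g \<in> F t" by (rule subgroup.m_closed[OF F])
lemma C_mult: "c \<in> C \<Longrightarrow> e \<in> C \<Longrightarrow> c \<otimes> e \<in> C" by (rule subgroup.m_closed[OF C])
lemma F_inv: "f \<in> F t \<Longrightarrow> inv f \<in> F t" by (rule subgroup.m_inv_closed[OF F])
lemma C_inv: "c \<in> C \<Longrightarrow> inv c \<in> C" by (rule subgroup.m_inv_closed[OF C])

lemma inv_cancel: "x \<in> carrier G \<Longrightarrow> y \<in> carrier G \<Longrightarrow> inv x \<otimes> (x \<otimes> y) = y"
  and cancel_inv: "x \<in> carrier G \<Longrightarrow> y \<in> carrier G \<Longrightarrow> x \<otimes> (inv x \<otimes> y) = y"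
  and mult_inv_cancel: "x \<in> carrier G \<Longrightarrow> y \<in> carrier G \<Longrightarrow> x \<otimes> y \<otimes> inv y = x"
  by (simp_all flip: m_assoc) (simp add: m_assoc)

lemma F_cancel:
  assumes "f \<in> F t" "f \<notin> C"
  shows "x \<in> carrier G \<Longrightarrow> f \<otimes> x \<in> C \<Longrightarrow> x \<in> F t - C"
    and "c \<in> C \<Longrightarrow> f \<otimes> c \<in> F t - C" and "c \<in> C \<Longrightarrow> c \<otimes> f \<in> F t - C" and "inv f \<in> F t - C"
proof -
  have f: "f \<in> carrier G" using assms F_closed by blast
  show inv: "inv f \<in> F t - C"
    using assms f F_inv C_inv[of "inv f"] by auto
  show fc: "f \<otimes> c \<in> F t - C" if c: "c \<in> C" for c
  proof -
    have "f \<otimes> c \<in> C \<Longrightarrow> (f \<otimes> c) \<otimes> inv c \<in> C" using C_mult C_inv c by blast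
    then have "f \<otimes> c \<notin> C" using mult_inv_cancel[OF f C_closed[OF c]] assms(2) by auto
    then show ?thesis using F_mult[OF assms(1)] CF c by blast
  qed
  show "c \<otimes> f \<in> F t - C" if c: "c \<in> C"
  proof -
    have "c \<otimes> f \<in> C \<Longrightarrow> inv c \<otimes> (c \<otimes> f) \<in> C" using C_mult C_inv c by blast
    then have "c \<otimes> f \<notin> C" using inv_cancel[OF C_closed[OF c] f] assms(2) by auto
    then show ?thesis using F_mult[OF _ assms(1)] CF c by blast
  qed
  show "x \<in> F t - C" if x: "x \<in> carrier G" "f \<otimes> x \<in> C"
  proof -
    have "inv f \<otimes> (f \<otimes> x) \<in> F t" using inv x(2) F_mult CF by blast
    then have "x \<in> F t" using inv_cancel[OF f x(1)] by simp
    moreover have "x \<notin> C" using fc[of x] x by blast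
    ultimately show ?thesis by blast
  qed
qed

lemma F_not_other_side: "f \<in> F t \<Longrightarrow> f \<notin> H (\<not> t)"
  using first[of f t] sides[of t] C_side[of "\<not> t"] by blast

text \<open>
  A set closed under right multiplication by both factors is a union of path components of a
  connected graph. Statements about all of \<open>G\<close> are proved below by checking that the set of
  counterexamples is invariant in this sense, while it misses a particular element.
\<close>

lemma invariant_eq_carrier:
  assumes Z: "Z \<subseteq> carrier G" "z0 \<in> Z" and inv: "\<And>z f t. z \<in> Z \<Longrightarrow> f \<in> F t \<Longrightarrow> z \<otimes> f \<in> Z"
  shows "Z = carrier G"
proof -
  have inv': "z \<otimes> inv f \<in> Z" if "z \<in> Z" "f \<in> F t" for z f t
    using that inv subgroup.m_inv_closed[OF F] by blast
  have act: "\<forall>z\<in>Z. z \<otimes> x \<in> Z" if "x \<in> generate G (F True \<union> F False)" for x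
    using that
  proof (induction rule: generate.induct)
    case (eng g h)
    then have "g \<in> carrier G" "h \<in> carrier G" using gen by auto
    then have "z \<otimes> (g \<otimes> h) = (z \<otimes> g) \<otimes> h" if "z \<in> Z" for z
      using that Z by (simp add: m_assoc subset_iff)
    then show ?case using eng.IH by simp
  qed (use Z inv inv' in auto)
  have "g \<in> Z" if g: "g \<in> carrier G" for g
  proof -
    have z0: "z0 \<in> carrier G" using Z by blast
    then have "z0 \<otimes> (inv z0 \<otimes> g) = g" using g by (simp flip: m_assoc)
    then show ?thesis using act[of "inv z0 \<otimes> g"] z0 g gen Z(2) by force
  qed
  then show ?thesis using Z(1) by blast
qed

lemma enter_side:
  assumes "x \<in> carrier G" "f \<in> F u" "x \<otimes> f \<in> H t" "x \<notin> H t"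
  shows "u = t \<and> x \<in> C"
proof -
  have x: "x = (x \<otimes> f) \<otimes> inv f" using assms F_closed by (simp add: m_assoc)
  have f: "inv f \<in> F u" using subgroup.m_inv_closed[OF F assms(2)] .
  have "u = t"
  proof (rule ccontr)
    assume "u \<noteq> t"
    then have "u = (\<not> t)" by auto
    then show False using keep[OF assms(3), of "inv f"] f x assms(4) by simp
  qed
  then show ?thesis using cross[OF assms(3), of "inv f"] f x assms(4) by auto
qed

text \<open>
  The complement of \<open>H t\<close> is mapped into \<open>H t\<close>. Otherwise some element lies outside \<open>H t\<close> and
  outside its translate by \<open>inv f\<close>; the set of these is invariant, because a step into either
  half-space would have to start on the edge \<open>C\<close> or \<open>inv f C\<close>, and each of these edges lies inside the
  other half-space.
\<close>

lemma ping_pong: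
  assumes f: "f \<in> F t" "f \<notin> C" and x: "x \<in> C \<union> H (\<not> t)"
  shows "f \<otimes> x \<in> H t"
proof (rule ccontr)
  assume fx: "f \<otimes> x \<notin> H t"
  define Z where "Z = {x \<in> carrier G. x \<notin> H t \<and> f \<otimes> x \<notin> H t}"
  have fG: "f \<in> carrier G" using f F_closed by blast
  have "x \<in> carrier G" using x closed by blast
  then have "x \<in> Z" using x fx not_side[of x t] by (simp add: Z_def)
  moreover have "z \<otimes> g \<in> Z" if z: "z \<in> Z" and g: "g \<in> F u" for z g u
  proof (rule ccontr)
    assume "z \<otimes> g \<notin> Z"
    moreover have c: "z \<in> carrier G" "g \<in> carrier G" using z g F_closed by (auto simp: Z_def)
    ultimately have "z \<otimes> g \<in> H t \<or> f \<otimes> z \<otimes> g \<in> H t" using fG by (simp add: Z_def m_assoc)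
    then show False
    proof
      assume "z \<otimes> g \<in> H t"
      then have "z \<in> C" using enter_side[OF c(1) g] z by (simp add: Z_def)
      then have "f \<otimes> z \<in> H t" using F_cancel(2)[OF f] first by blast
      then show False using z by (simp add: Z_def)
    next
      assume "f \<otimes> z \<otimes> g \<in> H t"
      then have "f \<otimes> z \<in> C" using enter_side[OF _ g, of "f \<otimes> z" t] z c fG by (simp add: Z_def)
      then have "z \<in> H t" using F_cancel(1)[OF f c(1)] first by blast
      then show False using z by (simp add: Z_def)
    qed
  qed
  ultimately have "Z = carrier G" by (intro invariant_eq_carrier[of Z x]) (auto simp: Z_def)
  then have "\<one> \<in> Z" by simp
  then show False using first[OF f] fG by (simp add: Z_def)
qed

text \<open>
  \<open>C\<close> fixes the edge \<open>C\<close> and its end points, hence preserves the two sides.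
\<close>

lemma C_mult_side:
  assumes c: "c \<in> C" and x: "x \<in> H t"
  shows "c \<otimes> x \<in> H t"
proof (rule ccontr)
  assume cx: "c \<otimes> x \<notin> H t"
  define Z where "Z = {x \<in> H t. c \<otimes> x \<notin> H t}"
  have cG: "c \<in> carrier G" using c C_closed by blast
  have ZG: "Z \<subseteq> carrier G" using H_closed by (auto simp: Z_def)
  have "z \<otimes> g \<in> Z" if z: "z \<in> Z" and g: "g \<in> F u" for z g u
  proof (rule ccontr)
    assume "z \<otimes> g \<notin> Z"
    moreover have zg: "z \<in> carrier G" "g \<in> carrier G" using z g F_closed ZG by auto
    ultimately consider "z \<otimes> g \<notin> H t" | "c \<otimes> z \<otimes> g \<in> H t" using cG by (auto simp: Z_def m_assoc)
    then show False
    proof cases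
      case 1
      have zH: "z \<in> H t" using z by (simp add: Z_def)
      have "u = t" using keep[OF zH, of g] 1 g by (cases "u = t") auto
      then have "z \<otimes> g \<in> C" using cross[OF zH, of g] 1 g by blast
      then have "(z \<otimes> g) \<otimes> inv g \<in> F t" using g \<open>u = t\<close> CF F_mult F_inv by blast
      then have "z \<in> F t" using mult_inv_cancel[OF zg] by simp
      moreover have "z \<notin> C" using zH C_side[of t] by blast
      ultimately have "c \<otimes> z \<in> H t" using F_cancel(3)[of z t c] c first by blast
      then show False using z by (simp add: Z_def)
    next
      case 2
      then have "c \<otimes> z \<in> C" using enter_side[OF _ g, of "c \<otimes> z" t] z zg cG by (simp add: Z_def)
      then have "inv c \<otimes> (c \<otimes> z) \<in> C" using c C_mult C_inv by blast
      then have "z \<in> C" using inv_cancel[OF cG zg(1)] by simp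
      then show False using z C_side[of t] by (auto simp: Z_def)
    qed
  qed
  then have "Z = carrier G" by (intro invariant_eq_carrier[of Z x]) (use x cx ZG in \<open>auto simp: Z_def\<close>)
  then show False using one_not_side by (auto simp: Z_def)
qed

section \<open>Levels and branches\<close>

text \<open>
  \<open>reduced m t\<close> is the set of products of \<open>m\<close> alternating factors outside \<open>C\<close>, the last of them from
  \<open>F t\<close>. For \<open>m = 0\<close> it is \<open>C\<close> for either \<open>t\<close>, so an element of \<open>C\<close> may be continued by both factors.
\<close>

primrec reduced :: "nat \<Rightarrow> bool \<Rightarrow> 'a set" where
  "reduced 0 t = C"
| "reduced (Suc m) t = {x \<otimes> f |x f. x \<in> reduced m (\<not> t) \<and> f \<in> F t - C}"

text \<open>
  For \<open>y \<in> reduced m (\<not> t)\<close> these are the elements whose edges lie beyond \<open>y C\<close>, as seen from the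
  base edge: \<open>y C\<close> hangs from the vertex \<open>y F (\<not> t)\<close>, and \<open>y F t\<close> is its far end.
\<close>

definition branch :: "bool \<Rightarrow> 'a \<Rightarrow> 'a set" where
  "branch t y = (\<otimes>) y ` H t"

text \<open>
  The edge of level \<open>m\<close> on the way to \<open>g\<close>, encoded as the set of all pairs that represent it. Equality
  of these sets is then equality of edges.
\<close>

definition ancestors :: "nat \<Rightarrow> 'a \<Rightarrow> (bool \<times> 'a) set" where
  "ancestors m g = {(t, y). y \<in> reduced m (\<not> t) \<and> g \<in> branch t y}"

definition level :: "'a \<Rightarrow> nat" where
  "level g = (LEAST m. \<exists>t. g \<in> reduced m t)"

definition level_ball :: "nat \<Rightarrow> 'a set" where
  "level_ball k = {g \<in> carrier G. level g \<le> k}"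

lemma reduced_closed: "x \<in> reduced m t \<Longrightarrow> x \<in> carrier G"
  by (induction m arbitrary: t x) (use closed in auto)

lemma branch_closed: "y \<in> carrier G \<Longrightarrow> branch t y \<subseteq> carrier G"
  using H_closed by (auto simp: branch_def)

lemma branch_iff: "y \<in> carrier G \<Longrightarrow> g \<in> carrier G \<Longrightarrow> g \<in> branch t y \<longleftrightarrow> inv y \<otimes> g \<in> H t"
proof
  assume y: "y \<in> carrier G" "g \<in> carrier G" "inv y \<otimes> g \<in> H t"
  then show "g \<in> branch t y" unfolding branch_def
    by (intro image_eqI[of _ _ "inv y \<otimes> g"]) (simp_all add: cancel_inv)
next
  assume y: "y \<in> carrier G" "g \<in> carrier G" "g \<in> branch t y"
  then obtain h where "h \<in> H t" "g = y \<otimes> h" by (auto simp: branch_def)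
  then show "inv y \<otimes> g \<in> H t" using y H_closed by (simp flip: m_assoc)
qed

lemma reduced_mult_C: "x \<in> reduced m t \<Longrightarrow> c \<in> C \<Longrightarrow> x \<otimes> c \<in> reduced m t"
proof (cases m)
  case (Suc k)
  assume "x \<in> reduced m t" "c \<in> C"
  then obtain y f where y: "y \<in> reduced k (\<not> t)" "f \<in> F t" "f \<notin> C" "x = y \<otimes> f" using Suc by auto
  then have "x \<otimes> c = y \<otimes> (f \<otimes> c)"
    using \<open>c \<in> C\<close> reduced_closed closed by (simp add: m_assoc)
  then show ?thesis using y F_cancel(2)[OF y(2,3) \<open>c \<in> C\<close>] Suc by auto
qed (simp add: subgroup.m_closed[OF C])

lemma C_mult_reduced: "c \<in> C \<Longrightarrow> x \<in> reduced m t \<Longrightarrow> c \<otimes> x \<in> reduced m t"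
proof (induction m arbitrary: t x)
  case (Suc m)
  then obtain y f where y: "y \<in> reduced m (\<not> t)" "f \<in> F t - C" "x = y \<otimes> f" by auto
  then have "y \<in> carrier G" "f \<in> carrier G" "c \<in> carrier G"
    using \<open>c \<in> C\<close> reduced_closed closed by blast+
  then have "c \<otimes> x = (c \<otimes> y) \<otimes> f" using y(3) by (simp add: m_assoc)
  then show ?case using Suc.IH[OF Suc.prems(1) y(1)] y(2) by auto
qed (simp add: subgroup.m_closed[OF C])

text \<open>
  An edge is not beyond another edge of its own level. Let \<open>f\<close> and \<open>g\<close> be the last letters of \<open>x\<close> and
  \<open>y\<close>. By induction the middle part \<open>z\<close> is not in \<open>H (\<not> t)\<close>. Multiplication by \<open>f\<close> preserves this, and
  \<open>inv g \<in> F (\<not> t)\<close> then sends the product to \<open>H (\<not> t)\<close> by \<open>ping_pong\<close>. The exception is \<open>z \<in> C\<close> with \<open>f\<close>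
  and \<open>g\<close> from the same factor; then the whole product stays in \<open>F (\<not> t)\<close>, which is disjoint from \<open>H t\<close>.
\<close>

lemma same_level_not_side:
  "x \<in> reduced m s \<Longrightarrow> y \<in> reduced m (\<not> t) \<Longrightarrow> inv y \<otimes> x \<notin> H t"
proof (induction m arbitrary: s t x y)
  case 0
  then have "inv y \<otimes> x \<in> C" using subgroup.m_closed[OF C] subgroup.m_inv_closed[OF C] by simp
  then show ?case using C_side[of t] by blast
next
  case (Suc m)
  obtain x' f where x: "x' \<in> reduced m (\<not> s)" "f \<in> F s" "f \<notin> C" "x = x' \<otimes> f"
    using Suc.prems(1) by auto
  obtain y' g where y: "y' \<in> reduced m (\<not> (\<not> t))" "g \<in> F (\<not> t)" "g \<notin> C" "y = y' \<otimes> g"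
    using Suc.prems(2) by auto
  define z where "z = inv y' \<otimes> x'"
  have c: "x' \<in> carrier G" "y' \<in> carrier G" "f \<in> carrier G" "g \<in> carrier G" "z \<in> carrier G"
    using x y reduced_closed F_closed by (auto simp: z_def)
  have eq: "inv y \<otimes> x = inv g \<otimes> (z \<otimes> f)"
    using c x(4) y(4) by (simp add: inv_mult_group m_assoc z_def)
  have "z \<notin> H (\<not> t)" using Suc.IH[OF x(1) y(1)] by (simp add: z_def)
  then have z: "z \<in> C \<union> H t" using not_side[OF c(5), of "\<not> t"] by simp
  have ig: "inv g \<in> F (\<not> t)" "inv g \<notin> C" using F_cancel(4)[OF y(2,3)] by auto
  show ?case
  proof (cases "z \<otimes> f \<in> C \<union> H t")
    case True
    then have "inv g \<otimes> (z \<otimes> f) \<in> H (\<not> t)" using ping_pong[OF ig] by simp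
    then show ?thesis unfolding eq using sides[of t] by blast
  next
    case False
    have "s \<noteq> t"
    proof
      assume st: "s = t"
      have "z \<in> C \<Longrightarrow> z \<otimes> f \<in> H t" using F_cancel(3)[OF x(2,3)] first st by blast
      moreover have "z \<in> H t \<Longrightarrow> z \<otimes> f \<in> H t \<union> C" using cross x(2) st by blast
      ultimately show False using z False by blast
    qed
    then have s: "s = (\<not> t)" by auto
    have "z \<in> C" using z False keep[of z t f] x(2) s by auto
    then have "z \<otimes> f \<in> F (\<not> t)" using F_cancel(3)[OF x(2,3)] s by blast
    then have "inv g \<otimes> (z \<otimes> f) \<in> F (\<not> t)" using ig subgroup.m_closed[OF F] by blast
    then show ?thesis unfolding eq using F_not_other_side[of _ "\<not> t"] by auto
  qed
qed

lemma same_level_not_branch: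
  assumes "x \<in> reduced m s" "y \<in> reduced m (\<not> t)"
  shows "x \<notin> branch t y"
  using same_level_not_side[OF assms] branch_iff[of y x t] assms[THEN reduced_closed] by simp

lemma branch_step:
  assumes "y \<in> carrier G" "p \<in> branch t y" "f \<in> F u"
  shows "p \<otimes> f \<in> branch t y \<union> (\<otimes>) y ` C"
proof -
  obtain h where h: "h \<in> H t" "p = y \<otimes> h" using assms(2) by (auto simp: branch_def)
  then have "p \<otimes> f = y \<otimes> (h \<otimes> f)" using assms H_closed F_closed by (simp add: m_assoc)
  moreover have "h \<otimes> f \<in> H t \<union> C"
    using cross[OF h(1), of f] keep[OF h(1), of f] assms(3) by (cases "u = t") auto
  ultimately show ?thesis by (auto simp: branch_def)
qed

text \<open>
  The intersection of two branches is invariant unless a step leaves it, and it is not all of \<open>G\<close>. A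
  step out of it lands on one of the edges \<open>y C\<close>, \<open>y' C\<close>; as these have the same level, neither lies
  in the branch at the other, so that step leaves both branches and lands on both edges.
\<close>

lemma branch_unique:
  assumes y: "y \<in> reduced m (\<not> t)" and y': "y' \<in> reduced m (\<not> t')"
    and p: "p \<in> branch t y" "p \<in> branch t' y'"
  shows "t = t'" and "inv y \<otimes> y' \<in> C"
proof -
  define Z where "Z = branch t y \<inter> branch t' y'"
  have c: "y \<in> carrier G" "y' \<in> carrier G" using y y' reduced_closed by auto
  have "Z \<subseteq> carrier G" using branch_closed[OF c(1)] by (auto simp: Z_def)
  moreover have "Z \<noteq> carrier G" using same_level_not_branch[OF y y] c by (auto simp: Z_def)
  moreover have "p \<in> Z" using p by (simp add: Z_def)
  ultimately obtain z f u where z: "z \<in> Z" "f \<in> F u" "z \<otimes> f \<notin> Z"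
    using invariant_eq_carrier[of Z p] by blast
  have b: "z \<otimes> f \<in> branch t y \<union> (\<otimes>) y ` C" "z \<otimes> f \<in> branch t' y' \<union> (\<otimes>) y' ` C"
    using branch_step[OF c(1) _ z(2)] branch_step[OF c(2) _ z(2)] z(1) by (auto simp: Z_def)
  have yC: "q \<notin> branch t' y'" if "q \<in> (\<otimes>) y ` C" for q
    using that reduced_mult_C[OF y] same_level_not_branch[OF _ y'] by blast
  have y'C: "q \<notin> branch t y" if "q \<in> (\<otimes>) y' ` C" for q
    using that reduced_mult_C[OF y'] same_level_not_branch[OF _ y] by blast
  have "z \<otimes> f \<in> (\<otimes>) y ` C" "z \<otimes> f \<in> (\<otimes>) y' ` C"
    using b yC y'C z(3) by (auto simp: Z_def)
  then obtain a a' where a: "a \<in> C" "a' \<in> C" "y \<otimes> a = y' \<otimes> a'" by force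
  then have aG: "a \<in> carrier G" "a' \<in> carrier G" using C_closed by auto
  have "inv y \<otimes> y' = inv y \<otimes> (y' \<otimes> a') \<otimes> inv a'" using c aG by (simp add: m_assoc)
  also have "\<dots> = a \<otimes> inv a'" using c aG by (simp flip: a(3) m_assoc)
  finally show yy': "inv y \<otimes> y' \<in> C"
    using a subgroup.m_closed[OF C] subgroup.m_inv_closed[OF C] by simp
  show "t = t'"
  proof (rule ccontr)
    assume "t \<noteq> t'"
    then have t': "t' = (\<not> t)" by auto
    have pG: "p \<in> carrier G" using p branch_closed[OF c(1)] by blast
    have "inv y' \<otimes> p \<in> H t'" using p(2) branch_iff c pG by blast
    then have "(inv y \<otimes> y') \<otimes> (inv y' \<otimes> p) \<in> H t'" by (rule C_mult_side[OF yy'])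
    moreover have "(inv y \<otimes> y') \<otimes> (inv y' \<otimes> p) = inv y \<otimes> p"
    proof -
      have "y' \<otimes> (inv y' \<otimes> p) = p" using c pG by (simp flip: m_assoc)
      then show ?thesis using c pG by (simp add: m_assoc)
    qed
    ultimately show False using p(1) branch_iff[OF c(1) pG] sides[of t] t' by auto
  qed
qed

lemma ancestors_eq:
  assumes "(t, y) \<in> ancestors m g" "(t, y) \<in> ancestors m h"
  shows "ancestors m g = ancestors m h"
proof -
  have *: "ancestors m p \<subseteq> ancestors m q"
    if p: "(t, y) \<in> ancestors m p" and q: "(t, y) \<in> ancestors m q" for p q
  proof
    fix a assume "a \<in> ancestors m p"
    then obtain t' y' where a: "a = (t', y')" "y' \<in> reduced m (\<not> t')" "p \<in> branch t' y'"
      by (auto simp: ancestors_def)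
    have y: "y \<in> reduced m (\<not> t)" "p \<in> branch t y" "q \<in> branch t y"
      using p q by (auto simp: ancestors_def)
    have u: "t' = t" "inv y' \<otimes> y \<in> C" using branch_unique[OF a(2) y(1) a(3) y(2)] by auto
    have c: "y \<in> carrier G" "y' \<in> carrier G" "q \<in> carrier G"
      using y a reduced_closed branch_closed by blast+
    have "inv y \<otimes> q \<in> H t" using y(3) branch_iff c by blast
    then have "(inv y' \<otimes> y) \<otimes> (inv y \<otimes> q) \<in> H t" by (rule C_mult_side[OF u(2)])
    moreover have "y \<otimes> (inv y \<otimes> q) = q" using c by (simp flip: m_assoc)
    ultimately have "q \<in> branch t y'" using branch_iff c by (simp add: m_assoc)
    then show "a \<in> ancestors m q" using a u by (simp add: ancestors_def)
  qed
  show ?thesis using *[OF assms] *[OF assms(2,1)] by blast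
qed

lemma reduced_mult:
  assumes g: "g \<in> reduced m s" and f: "f \<in> F u"
  shows "\<exists>l t. l \<le> Suc m \<and> g \<otimes> f \<in> reduced l t"
proof (cases "f \<in> C")
  case True
  then show ?thesis using reduced_mult_C[OF g] by (meson le_SucI order_refl)
next
  case fC: False
  show ?thesis
  proof (cases "u = s \<and> m \<noteq> 0")
    case False
    then have "g \<in> reduced m (\<not> u)" using g by (cases m) auto
    then have "g \<otimes> f \<in> reduced (Suc m) u" using f fC by auto
    then show ?thesis by blast
  next
    case True
    then obtain k where k: "m = Suc k" by (cases m) auto
    then obtain x h where x: "x \<in> reduced k (\<not> s)" "h \<in> F s" "h \<notin> C" "g = x \<otimes> h" using g by auto
    have gf: "g \<otimes> f = x \<otimes> (h \<otimes> f)"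
      using x f reduced_closed F_closed by (simp add: m_assoc)
    have hf: "h \<otimes> f \<in> F s" using x f True subgroup.m_closed[OF F] by blast
    show ?thesis
    proof (cases "h \<otimes> f \<in> C")
      case True
      then have "g \<otimes> f \<in> reduced k (\<not> s)" unfolding gf using x(1) by (rule reduced_mult_C[rotated])
      then show ?thesis using k by (intro exI[of _ k] exI[of _ "\<not> s"]) simp
    next
      case False
      then have "g \<otimes> f \<in> reduced m s" unfolding gf k using x(1) hf by auto
      then show ?thesis by (meson le_SucI order_refl)
    qed
  qed
qed

lemma reduced_exists:
  assumes "g \<in> carrier G"
  shows "\<exists>m t. g \<in> reduced m t"
proof -
  let ?Z = "\<Union>m. \<Union>t. reduced m t"
  have "?Z = carrier G"
  proof (rule invariant_eq_carrier)
    show "?Z \<subseteq> carrier G" using reduced_closed by blast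
    show "\<one> \<in> ?Z" using subgroup.one_closed[OF C] by (auto intro!: exI[of _ 0])
    fix z f t assume "z \<in> ?Z" and f: "f \<in> F t"
    then obtain m s where "z \<in> reduced m s" by blast
    from reduced_mult[OF this f] show "z \<otimes> f \<in> ?Z" by blast
  qed
  then show ?thesis using assms by blast
qed

lemma level_reduced:
  assumes "g \<in> carrier G"
  obtains t where "g \<in> reduced (level g) t"
  using LeastI_ex[OF reduced_exists[OF assms]] unfolding level_def by blast

lemma level_le: "g \<in> reduced m t \<Longrightarrow> level g \<le> m"
  unfolding level_def by (rule Least_le) blast

lemma level_mult_le:
  assumes "g \<in> carrier G" "f \<in> F u"
  shows "level (g \<otimes> f) \<le> level g + 1"
proof -
  obtain s where "g \<in> reduced (level g) s" using level_reduced[OF assms(1)] .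
  from reduced_mult[OF this assms(2)] obtain l t where "l \<le> Suc (level g)" "g \<otimes> f \<in> reduced l t"
    by blast
  then show ?thesis using level_le[of "g \<otimes> f" l t] by simp
qed

lemma C_mult_level_ball:
  assumes "c \<in> C" "g \<in> level_ball k"
  shows "c \<otimes> g \<in> level_ball k"
proof -
  have g: "g \<in> carrier G" "level g \<le> k" using assms(2) by (auto simp: level_ball_def)
  obtain t where "g \<in> reduced (level g) t" using level_reduced[OF g(1)] .
  then have "c \<otimes> g \<in> reduced (level g) t" by (rule C_mult_reduced[OF assms(1)])
  then have "level (c \<otimes> g) \<le> level g" by (rule level_le)
  then show ?thesis using g assms(1) C_closed by (simp add: level_ball_def)
qed

lemma parent_branch:
  assumes y: "y \<in> reduced m t" and f: "f \<in> F (\<not> t)" "f \<notin> C" and x: "x = y \<otimes> f"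
  shows "branch t x \<union> (\<otimes>) x ` C \<subseteq> branch (\<not> t) y"
proof
  fix p assume "p \<in> branch t x \<union> (\<otimes>) x ` C"
  then obtain h where h: "h \<in> C \<union> H t" "p = x \<otimes> h" by (auto simp: branch_def)
  then have "p = y \<otimes> (f \<otimes> h)"
    using x f y reduced_closed closed by (auto simp: m_assoc)
  moreover have "f \<otimes> h \<in> H (\<not> t)" using ping_pong[OF f, of h] h by simp
  ultimately show "p \<in> branch (\<not> t) y" by (auto simp: branch_def)
qed

text \<open>
  Branches are nested along a reduced product (\<open>parent_branch\<close>), so \<open>x\<close> lies beyond the edge given by
  its initial segment \<open>y\<close> of length \<open>m\<close>. The remaining factor \<open>inv y \<otimes> x\<close> is a product of \<open>Suc k\<close>
  letters.
\<close>

lemma ancestor_of_edge: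
  "x \<in> reduced (m + Suc k) (\<not> t) \<Longrightarrow>
    \<exists>t' y. y \<in> reduced m (\<not> t') \<and> branch t x \<union> (\<otimes>) x ` C \<subseteq> branch t' y \<and>
      inv y \<otimes> x \<in> level_ball (Suc k)"
proof (induction k arbitrary: x t)
  case 0
  then obtain y f where y: "y \<in> reduced m t" "f \<in> F (\<not> t)" "f \<notin> C" "x = y \<otimes> f" by auto
  have c: "y \<in> carrier G" "f \<in> carrier G" using y reduced_closed F_closed by auto
  have "\<one> \<otimes> f \<in> reduced (Suc 0) (\<not> t)"
    using y(2,3) subgroup.one_closed[OF C] by (simp only: reduced.simps) blast
  then have "level f \<le> Suc 0" using c level_le[of f] by simp
  moreover have "inv y \<otimes> x = f" using c y(4) by (simp add: inv_cancel)
  ultimately have "inv y \<otimes> x \<in> level_ball (Suc 0)" using c by (simp add: level_ball_def)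
  then show ?case using parent_branch[OF y] y(1) by (intro exI[of _ "\<not> t"] exI[of _ y]) simp
next
  case (Suc k)
  then obtain z f where z: "z \<in> reduced (m + Suc k) t" "f \<in> F (\<not> t)" "f \<notin> C" "x = z \<otimes> f" by auto
  have "z \<in> reduced (m + Suc k) (\<not> (\<not> t))" using z(1) by simp
  from Suc.IH[OF this] obtain t' y where y: "y \<in> reduced m (\<not> t')"
    "branch (\<not> t) z \<subseteq> branch t' y" "inv y \<otimes> z \<in> level_ball (Suc k)" by blast
  have c: "y \<in> carrier G" "z \<in> carrier G" "f \<in> carrier G"
    using y(1) z reduced_closed F_closed by auto
  have "inv y \<otimes> x = (inv y \<otimes> z) \<otimes> f" using c z(4) by (simp add: m_assoc)
  then have "inv y \<otimes> x \<in> level_ball (Suc (Suc k))"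
    using y(3) c level_mult_le[of "inv y \<otimes> z" f "\<not> t"] z(2) by (simp add: level_ball_def)
  then show ?case using parent_branch[OF z] y by blast
qed

lemma ancestor_exists:
  assumes "g \<in> reduced (m + Suc k) s"
  obtains t y where "(t, y) \<in> ancestors m g" "inv y \<otimes> g \<in> level_ball (Suc k)"
proof -
  have "g \<in> reduced (m + Suc k) (\<not> (\<not> s))" using assms by simp
  from ancestor_of_edge[OF this] obtain t y where y: "y \<in> reduced m (\<not> t)"
    "(\<otimes>) g ` C \<subseteq> branch t y" "inv y \<otimes> g \<in> level_ball (Suc k)" by blast
  have "g \<in> (\<otimes>) g ` C"
    using reduced_closed[OF assms] subgroup.one_closed[OF C] by (intro image_eqI[of _ _ \<one>]) auto
  then show thesis using that y by (auto simp: ancestors_def)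
qed

text \<open>
  Reduced products of different lengths represent different elements: the longer one lies beyond an
  edge of the level of the shorter one, which is impossible by \<open>same_level_not_branch\<close>.
\<close>

lemma level_eq:
  assumes "g \<in> reduced m t"
  shows "level g = m"
proof (rule ccontr)
  assume "level g \<noteq> m"
  then have "level g < m" using level_le[OF assms] by simp
  then obtain k where "m = level g + Suc k" by (metis add_Suc_right less_iff_Suc_add)
  then obtain t' y where "(t', y) \<in> ancestors (level g) g" using assms ancestor_exists by metis
  moreover obtain s where "g \<in> reduced (level g) s" using assms reduced_closed level_reduced by metis
  ultimately show False using same_level_not_branch by (auto simp: ancestors_def)
qed

lemma ancestors_nonempty:
  assumes "g \<in> carrier G" "m < level g"
  shows "ancestors m g \<noteq> {}"
proof -
  obtain k where k: "level g = m + Suc k" using assms(2) by (metis add_Suc_right less_iff_Suc_add)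
  then obtain s where "g \<in> reduced (m + Suc k) s" using level_reduced[OF assms(1)] by metis
  from ancestor_exists[OF this] show ?thesis by blast
qed

text \<open>
  Representatives of one edge differ by an element of \<open>C\<close>. This carries what is known about the
  representative coming from a reduced product to all representatives.
\<close>

lemma ancestor_cancel:
  assumes "(t, y) \<in> ancestors m g" "(t', y') \<in> ancestors m g"
  shows "t = t'" "inv y \<otimes> y' \<in> C" "inv y \<otimes> g = (inv y \<otimes> y') \<otimes> (inv y' \<otimes> g)"
proof -
  have a: "y \<in> reduced m (\<not> t)" "g \<in> branch t y" "y' \<in> reduced m (\<not> t')" "g \<in> branch t' y'"
    using assms by (auto simp: ancestors_def)
  show "t = t'" "inv y \<otimes> y' \<in> C" using branch_unique[OF a(1,3,2,4)] by auto
  have c: "y \<in> carrier G" "y' \<in> carrier G" "g \<in> carrier G"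
    using a reduced_closed branch_closed by blast+
  have "y' \<otimes> (inv y' \<otimes> g) = g" using c by (simp flip: m_assoc)
  then show "inv y \<otimes> g = (inv y \<otimes> y') \<otimes> (inv y' \<otimes> g)" using c by (simp add: m_assoc)
qed

lemma ancestor_level_ball:
  assumes "g \<in> carrier G" "m < level g" "(t, y) \<in> ancestors m g"
  shows "inv y \<otimes> g \<in> level_ball (level g - m)"
proof -
  obtain k where k: "level g = m + Suc k" using assms(2) by (metis add_Suc_right less_iff_Suc_add)
  then obtain s where "g \<in> reduced (m + Suc k) s" using level_reduced[OF assms(1)] by metis
  from ancestor_exists[OF this] obtain t' y' where
    y': "(t', y') \<in> ancestors m g" "inv y' \<otimes> g \<in> level_ball (Suc k)" by blast
  show ?thesis
    using C_mult_level_ball[OF ancestor_cancel(2)[OF assms(3) y'(1)] y'(2)]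
      ancestor_cancel(3)[OF assms(3) y'(1)] k by simp
qed

lemma ancestor_one_below:
  assumes "g \<in> carrier G" "level g = Suc m" "(t, y) \<in> ancestors m g"
  shows "inv y \<otimes> g \<in> F t"
proof -
  obtain s where "g \<in> reduced (Suc m) s" using level_reduced[OF assms(1)] assms(2) by metis
  then obtain x f where x: "x \<in> reduced m (\<not> s)" "f \<in> F s" "f \<notin> C" "g = x \<otimes> f" by auto
  have c: "x \<in> carrier G" "f \<in> carrier G" using x reduced_closed F_closed by auto
  have xg: "inv x \<otimes> g = f" using c x(4) by (simp add: inv_cancel)
  have "g \<in> branch s x" using first[OF x(2,3)] x(4) by (auto simp: branch_def)
  then have a: "(s, x) \<in> ancestors m g" using x(1) by (simp add: ancestors_def)
  show ?thesis
    using ancestor_cancel[OF assms(3) a] F_cancel(3)[OF x(2,3)] xg by auto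
qed

end

section \<open>Dimension of a split group\<close>

text \<open>
  Generators are taken from the factors, so that every step of a path is a move around one vertex of
  the tree.
\<close>

locale metric_splitting = splitting +
  fixes S :: "'a set" and n :: nat
  assumes S: "finite_generating_set G S" and SF: "S \<subseteq> F True \<union> F False"
    and dim_F: "asdim_at_most (word_dist G S) n (F t)"
begin

sublocale Metric_space "carrier G" "word_dist G S" by (rule word_metric[OF S])

abbreviation "dst \<equiv> word_dist G S"

lemma letter_in_F: "s \<in> S \<union> m_inv G ` S \<Longrightarrow> \<exists>t. s \<in> F t"
  using SF F_inv by blast

lemma level_lipschitz:
  assumes "g \<in> carrier G" "h \<in> carrier G"
  shows "level h \<le> level g + dst g h"
proof (rule lipschitz_along_letters[OF S assms])
  fix p s assume p: "p \<in> carrier G" and s: "s \<in> S \<union> m_inv G ` S"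
  obtain t where "s \<in> F t" using letter_in_F[OF s] by blast
  then show "level (p \<otimes> s) \<le> level p + 1" by (rule level_mult_le[OF p])
qed

lemma ancestors_locally_constant:
  assumes g: "g \<in> carrier G" and h: "h \<in> carrier G" "dst g h < r" and m: "m < level g"
    and far: "\<And>e. e \<in> carrier G \<Longrightarrow> level e = m \<Longrightarrow> r \<le> dst g e"
  shows "ancestors m g = ancestors m h"
proof -
  obtain t y where ty: "(t, y) \<in> ancestors m g" using ancestors_nonempty[OF g m] by auto
  then have y: "y \<in> reduced m (\<not> t)" "g \<in> branch t y" by (auto simp: ancestors_def)
  have yG: "y \<in> carrier G" using y(1) by (rule reduced_closed)
  have "h \<in> branch t y"
  proof (rule stay_inside[OF S branch_closed[OF yG] _ _ y(2) h])
    fix p s assume p: "p \<in> branch t y" and s: "s \<in> S \<union> m_inv G ` S"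
    obtain u where "s \<in> F u" using letter_in_F[OF s] by blast
    then show "p \<otimes> s \<in> branch t y \<union> (\<otimes>) y ` C" by (rule branch_step[OF yG p])
  next
    fix e assume "e \<in> (\<otimes>) y ` C"
    then have "e \<in> reduced m (\<not> t)" using reduced_mult_C[OF y(1)] by blast
    then show "r \<le> dst g e" using far[of e] reduced_closed level_eq by blast
  qed
  then have "(t, y) \<in> ancestors m h" using y(1) by (simp add: ancestors_def)
  then show ?thesis using ancestors_eq[OF ty] by blast
qed

text \<open>
  A set \<open>Z\<close> above level \<open>m\<close>, and at distance at least \<open>r\<close> from that level,
  falls into pieces, one for each edge of level \<open>m\<close>; translating each piece to the base edge puts it
  into one of the two sets \<open>W t\<close>.
\<close>

lemma colourable_over_level:
  assumes Z: "Z \<subseteq> carrier G" and above: "\<And>g. g \<in> Z \<Longrightarrow> m < level g"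
    and far: "\<And>g e. g \<in> Z \<Longrightarrow> e \<in> carrier G \<Longrightarrow> level e = m \<Longrightarrow> r \<le> dst g e"
    and W: "\<And>g t y. g \<in> Z \<Longrightarrow> (t, y) \<in> ancestors m g \<Longrightarrow> inv y \<otimes> g \<in> W t"
    and col: "\<And>t. colourable dst n r D (W t)"
  shows "colourable dst n r D Z"
proof (rule colourable_disjoint_union[where f = "ancestors m"])
  show "ancestors m g = ancestors m h" if "g \<in> Z" "h \<in> Z" "dst g h < r" for g h
    using that Z above far by (intro ancestors_locally_constant[where r = r]) auto
next
  fix a
  show "colourable dst n r D {g \<in> Z. ancestors m g = a}"
  proof (cases "a = {}")
    case True
    then have empty: "{g \<in> Z. ancestors m g = a} = {}" using ancestors_nonempty above Z by blast
    show ?thesis unfolding empty colourable_def by simp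
  next
    case False
    then obtain t y where ty: "(t, y) \<in> a" by auto
    show ?thesis
    proof (rule colourable_pullback[where \<phi> = "\<lambda>g. inv y \<otimes> g", OF col[of t]])
      fix g assume g: "g \<in> {g \<in> Z. ancestors m g = a}"
      then show "inv y \<otimes> g \<in> W t" using W ty by blast
      have "y \<in> carrier G" using g ty reduced_closed by (auto simp: ancestors_def)
      then have iso: "dst (inv y \<otimes> g) (inv y \<otimes> h) = dst g h" if "h \<in> Z" for h
        using that g Z by (intro word_dist_left_invariant) auto
      fix h assume h: "h \<in> {g \<in> Z. ancestors m g = a}"
      show "dst g h < r \<Longrightarrow> dst (inv y \<otimes> g) (inv y \<otimes> h) < r"
        "dst (inv y \<otimes> g) (inv y \<otimes> h) \<le> D \<Longrightarrow> dst g h \<le> D"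
        using iso[of h] h by simp_all
    qed
  qed
qed

lemma level_ball_0: "level_ball 0 \<subseteq> F True"
proof
  fix g assume "g \<in> level_ball 0"
  then have "g \<in> carrier G" "level g = 0" by (auto simp: level_ball_def)
  then obtain t where "g \<in> reduced 0 t" using level_reduced by metis
  then show "g \<in> F True" using CF by auto
qed

text \<open>
  Moving each point to a nearby point of \<open>X\<close> changes distances by less than \<open>2 r\<close>.
\<close>

lemma asdim_neighbourhood:
  assumes dim: "asdim_at_most dst n X" and X: "X \<subseteq> carrier G"
  shows "asdim_at_most dst n {g \<in> carrier G. \<exists>e\<in>X. dst g e < r}"
    (is "asdim_at_most dst n ?N")
  unfolding asdim_at_most_def
proof (intro allI impI)
  fix s :: real assume "s > 0"
  have "\<forall>g\<in>?N. \<exists>e. e \<in> X \<and> dst g e < r" by blast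
  from bchoice[OF this] obtain \<phi> where
    \<phi>: "\<And>g. g \<in> ?N \<Longrightarrow> \<phi> g \<in> X" "\<And>g. g \<in> ?N \<Longrightarrow> dst g (\<phi> g) < r"
    by blast
  have near: "\<bar>dst (\<phi> g) (\<phi> h) - dst g h\<bar> < 2 * r" if gh: "g \<in> ?N" "h \<in> ?N" for g h
  proof -
    have c: "g \<in> carrier G" "h \<in> carrier G" "\<phi> g \<in> carrier G" "\<phi> h \<in> carrier G"
      using gh \<phi>(1) X by auto
    have "dst (\<phi> g) (\<phi> h) \<le> dst g (\<phi> g) + dst g h + dst h (\<phi> h)"
      using triangle[of "\<phi> g" g "\<phi> h"] triangle[of g h "\<phi> h"] commute[of g "\<phi> g"] c by simp
    moreover have "dst g h \<le> dst g (\<phi> g) + dst (\<phi> g) (\<phi> h) + dst h (\<phi> h)"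
      using triangle[of g "\<phi> g" h] triangle[of "\<phi> g" "\<phi> h" h] commute[of h "\<phi> h"] c by simp
    ultimately show ?thesis using \<phi>(2)[OF gh(1)] \<phi>(2)[OF gh(2)] by simp
  qed
  \<comment> \<open>The maximum keeps the scale positive for every real \<open>r\<close>.\<close>
  have "s + max 0 (2 * r) > 0" using \<open>s > 0\<close> by simp
  then obtain D where D: "colourable dst n (s + max 0 (2 * r)) D X"
    using dim unfolding asdim_at_most_def by blast
  have "colourable dst n s (D + 2 * r) ?N"
  proof (rule colourable_pullback[where \<phi> = \<phi>, OF D])
    fix g h assume gh: "g \<in> ?N" "h \<in> ?N"
    show "dst g h < s \<Longrightarrow> dst (\<phi> g) (\<phi> h) < s + max 0 (2 * r)"
      "dst (\<phi> g) (\<phi> h) \<le> D \<Longrightarrow> dst g h \<le> D + 2 * r"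
      using near[OF gh] by linarith+
  qed (rule \<phi>(1))
  then show "\<exists>D. colourable dst n s D ?N" ..
qed

text \<open>
  Elements of level \<open>k + 1\<close> that are \<open>r\<close>-far from \<open>level_ball k\<close> are coloured coset by coset; the
  rest lies in the \<open>r\<close>-neighbourhood \<open>N\<close> of \<open>level_ball k\<close>. The order of choices matters: \<open>R\<close> comes
  from the cosets, and only then is \<open>N\<close> coloured at the larger scale \<open>R + 2 r\<close>.
\<close>

lemma asdim_level_ball: "asdim_at_most dst n (level_ball k)"
proof (induction k)
  case 0
  show ?case using dim_F[of True] level_ball_0 by (rule asdim_at_most_subset)
next
  case (Suc k)
  show ?case unfolding asdim_at_most_def
  proof (intro allI impI)
    fix r :: real assume r: "r > 0"
    define N where "N = {g \<in> carrier G. \<exists>e\<in>level_ball k. dst g e < r}"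
    define Z where "Z = level_ball (Suc k) - N"
    have ballG: "level_ball k \<subseteq> carrier G" for k by (auto simp: level_ball_def)
    have NG: "N \<subseteq> carrier G" and ZG: "Z \<subseteq> carrier G" using ballG by (auto simp: N_def Z_def)
    have level_Z: "level g = Suc k" if "g \<in> Z" for g
    proof -
      have "g \<notin> level_ball k" using that r ZG by (force simp: N_def Z_def)
      then show ?thesis using that by (auto simp: Z_def level_ball_def)
    qed
    obtain D1 D2 where D: "colourable dst n r D1 (F True)" "colourable dst n r D2 (F False)"
      using dim_F r unfolding asdim_at_most_def by meson
    define R where "R = max D1 D2"
    have R: "colourable dst n r R (F t)" for t
      using colourable_mono[OF D(1), of "F t" r R] colourable_mono[OF D(2), of "F t" r R]
      by (cases t) (simp_all add: R_def)
    have "colourable dst n r R Z"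
    proof (rule colourable_over_level[where m = k and W = F])
      fix g e assume "g \<in> Z" "e \<in> carrier G" "level e = k"
      then show "r \<le> dst g e" by (force simp: Z_def N_def level_ball_def)
    next
      fix g t y assume "g \<in> Z" "(t, y) \<in> ancestors k g"
      then show "inv y \<otimes> g \<in> F t" using ancestor_one_below level_Z ZG by blast
    qed (use ZG level_Z R in auto)
    then have Z: "colourable dst n r (max 0 R) Z" by (rule colourable_mono) auto
    have "asdim_at_most dst n N" unfolding N_def by (rule asdim_neighbourhood[OF Suc.IH ballG])
    moreover have "max 0 R + 2 * r > 0" using r by simp
    ultimately obtain D where "colourable dst n (max 0 R + 2 * r) D N"
      unfolding asdim_at_most_def by blast
    then have N: "colourable dst n (max 0 R + 2 * r) (max 0 D) N" by (rule colourable_mono) auto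
    have "colourable dst n r (max 0 D + 2 * (max 0 R + r)) (N \<union> Z)"
      using colourable_union[OF Z N NG ZG r] by simp
    then have "colourable dst n r (max 0 D + 2 * (max 0 R + r)) (level_ball (Suc k))"
      by (rule colourable_mono) (auto simp: Z_def)
    then show "\<exists>D. colourable dst n r D (level_ball (Suc k))" ..
  qed
qed

text \<open>
  Annuli consist of \<open>q\<close> consecutive levels. The pieces of the annulus \<open>l + 1\<close> are cut out by the edges of
  level \<open>l q\<close>, one annulus further down: this leaves the distance \<open>q \<ge> r\<close> that separates the
  pieces, and a relative level below \<open>2 q\<close>.
\<close>

theorem asdim_split_group: "asdim_at_most dst (2 * n + 1) (carrier G)"
  unfolding asdim_at_most_def
proof (intro allI impI)
  fix r :: real assume r: "r > 0"
  define q where "q = nat \<lceil>r\<rceil>"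
  have q: "q > 0" "r \<le> q" using r by (simp_all add: q_def real_nat_ceiling_ge)
  obtain D where D: "colourable dst n r D (level_ball (2 * q))"
    using asdim_level_ball r unfolding asdim_at_most_def by blast
  have annulus: "colourable dst n r D {g \<in> carrier G. level g div q = k}" (is "colourable dst n r D ?Z")
    for k
  proof (cases k)
    case 0
    have "?Z \<subseteq> level_ball (2 * q)" using 0 q by (auto simp: level_ball_def div_eq_0_iff)
    then show ?thesis by (rule colourable_mono[OF D]) auto
  next
    case (Suc l)
    have level: "l * q + q \<le> level g" "level g < l * q + 2 * q" if "g \<in> ?Z" for g
    proof -
      have "level g = k * q + level g mod q" using that by (metis (mono_tags) div_mult_mod_eq mem_Collect_eq)
      then show "l * q + q \<le> level g" "level g < l * q + 2 * q"
        using Suc mod_less_divisor[OF q(1), of "level g"] by simp_all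
    qed
    show ?thesis
    proof (rule colourable_over_level[where m = "l * q" and W = "\<lambda>_. level_ball (2 * q)"])
      fix g assume g: "g \<in> ?Z"
      show "l * q < level g" using level(1)[OF g] q by simp
      have gG: "g \<in> carrier G" using g by simp
      show "r \<le> dst g e" if e: "e \<in> carrier G" "level e = l * q" for e
      proof -
        have "real (level g) \<le> level e + dst e g" using level_lipschitz[OF e(1) gG] .
        moreover have "real (l * q + q) \<le> level g" using level(1)[OF g] by (rule of_nat_mono)
        ultimately show ?thesis using e(2) q(2) commute[of e g] by simp
      qed
      show "inv y \<otimes> g \<in> level_ball (2 * q)" if "(t, y) \<in> ancestors (l * q) g" for t y
      proof -
        have "inv y \<otimes> g \<in> level_ball (level g - l * q)"
          using ancestor_level_ball[OF gG _ that] \<open>l * q < level g\<close> by blast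
        then show ?thesis using level(2)[OF g] by (auto simp: level_ball_def)
      qed
    qed (use D in auto)
  qed
  have parity: "colourable dst n r D {g \<in> carrier G. even (level g div q) = b}" (is "colourable dst n r D ?X")
    for b
  proof (rule colourable_disjoint_union[where f = "\<lambda>g. level g div q"])
    fix g h assume gh: "g \<in> ?X" "h \<in> ?X" "dst g h < r"
    have *: "\<not> level x div q < level y div q"
      if "x \<in> ?X" "y \<in> ?X" "dst x y < r" for x y
    proof
      assume less: "level x div q < level y div q"
      then have "level x div q + 2 \<le> level y div q" using that(1,2) by (cases b) (auto elim!: evenE oddE)
      then have "(level x div q + 2) * q \<le> level y div q * q" by (rule mult_le_mono1)
      also have "\<dots> \<le> level y" by simp
      finally have "level x div q * q + 2 * q \<le> level y" by (simp add: algebra_simps)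
      moreover have "level x < level x div q * q + q"
        using mod_less_divisor[OF q(1), of "level x"] div_mult_mod_eq[of "level x" q] by linarith
      ultimately have "level x + q < level y" by linarith
      then have "real (level x) + real q < real (level y)" by linarith
      moreover have "real (level y) \<le> level x + dst x y" using level_lipschitz[of x y] that by simp
      ultimately show False using that(3) q(2) by linarith
    qed
    show "level g div q = level h div q"
      using *[of g h] *[of h g] gh commute[of g h] by (metis linorder_neqE_nat)
  next
    show "colourable dst n r D {g \<in> ?X. level g div q = k}" for k
      by (rule colourable_mono[OF annulus[of k]]) auto
  qed
  have "colourable dst (2 * n + 1) r D
     ({g \<in> carrier G. even (level g div q) = True} \<union> {g \<in> carrier G. even (level g div q) = False})"
    by (rule colourable_two_parts[OF parity parity])
  then have "colourable dst (2 * n + 1) r D (carrier G)" by (rule colourable_mono) auto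
  then show "\<exists>D. colourable dst (2 * n + 1) r D (carrier G)" ..
qed

end

section \<open>Amalgamated products split\<close>

text \<open>
  \<open>A\<close> is free as a right \<open>C\<close>-set. A representative \<open>\<rho> a\<close> of each coset is chosen, and \<open>s a\<close> is the
  unique \<open>c\<close> with \<open>a = \<rho> a \<cdot> i c\<close>.
\<close>

lemma equivariant_section:
  assumes A: "group A" and C: "group C" and i: "i \<in> mon C A"
  obtains s where "\<And>a. a \<in> carrier A \<Longrightarrow> s a \<in> carrier C"
    and "\<And>a c. a \<in> carrier A \<Longrightarrow> c \<in> carrier C \<Longrightarrow> s (a \<otimes>\<^bsub>A\<^esub> i c) = s a \<otimes>\<^bsub>C\<^esub> c"
proof -
  interpret A: group A by fact
  interpret C: group C by fact
  have hom: "i \<in> hom C A" and inj: "inj_on i (carrier C)" using i by (auto simp: mon_def)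
  interpret i: group_hom C A i by unfold_locales (rule hom)
  define K where "K a = (\<lambda>c. a \<otimes>\<^bsub>A\<^esub> i c) ` carrier C" for a
  define \<rho> where "\<rho> a = (SOME x. x \<in> K a)" for a
  have K_mult: "K (a \<otimes>\<^bsub>A\<^esub> i c) = K a" if "a \<in> carrier A" "c \<in> carrier C" for a c
  proof -
    have "K (a \<otimes>\<^bsub>A\<^esub> i c) \<subseteq> K a" if "a \<in> carrier A" "c \<in> carrier C" for a c
      using that by (auto simp: K_def A.m_assoc simp flip: i.hom_mult)
    from this[OF that] this[of "a \<otimes>\<^bsub>A\<^esub> i c" "inv\<^bsub>C\<^esub> c"] that show ?thesis
      by (simp add: A.m_assoc)
  qed
  have \<rho>: "\<exists>c\<in>carrier C. a = \<rho> a \<otimes>\<^bsub>A\<^esub> i c" "\<rho> a \<in> carrier A" if a: "a \<in> carrier A" for a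
  proof -
    have "a \<otimes>\<^bsub>A\<^esub> i \<one>\<^bsub>C\<^esub> \<in> K a" unfolding K_def by blast
    then have "\<rho> a \<in> K a" unfolding \<rho>_def by (rule someI)
    then obtain c where c: "c \<in> carrier C" "\<rho> a = a \<otimes>\<^bsub>A\<^esub> i c" by (auto simp: K_def)
    then show "\<rho> a \<in> carrier A" using a by simp
    have "a = \<rho> a \<otimes>\<^bsub>A\<^esub> i (inv\<^bsub>C\<^esub> c)" using c a by (simp add: A.m_assoc)
    then show "\<exists>c\<in>carrier C. a = \<rho> a \<otimes>\<^bsub>A\<^esub> i c" using c(1) by blast
  qed
  define s where "s a = (SOME c. c \<in> carrier C \<and> a = \<rho> a \<otimes>\<^bsub>A\<^esub> i c)" for a
  have s: "s a \<in> carrier C" "\<rho> a \<otimes>\<^bsub>A\<^esub> i (s a) = a" if a: "a \<in> carrier A" for a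
  proof -
    have "\<exists>c. c \<in> carrier C \<and> a = \<rho> a \<otimes>\<^bsub>A\<^esub> i c" using \<rho>(1)[OF a] by blast
    from someI_ex[OF this] show "s a \<in> carrier C" "\<rho> a \<otimes>\<^bsub>A\<^esub> i (s a) = a"
      unfolding s_def by simp_all
  qed
  have "s (a \<otimes>\<^bsub>A\<^esub> i c) = s a \<otimes>\<^bsub>C\<^esub> c" if a: "a \<in> carrier A" and c: "c \<in> carrier C" for a c
  proof -
    let ?b = "a \<otimes>\<^bsub>A\<^esub> i c"
    have b: "?b \<in> carrier A" using a c by simp
    have "\<rho> ?b = \<rho> a" unfolding \<rho>_def K_mult[OF a c] ..
    then have "\<rho> a \<otimes>\<^bsub>A\<^esub> i (s ?b) = ?b" using s(2)[OF b] by simp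
    also have "\<dots> = \<rho> a \<otimes>\<^bsub>A\<^esub> i (s a) \<otimes>\<^bsub>A\<^esub> i c" using s(2)[OF a] by simp
    also have "\<dots> = \<rho> a \<otimes>\<^bsub>A\<^esub> i (s a \<otimes>\<^bsub>C\<^esub> c)" using s(1)[OF a] \<rho>(2)[OF a] c by (simp add: A.m_assoc)
    finally have "i (s ?b) = i (s a \<otimes>\<^bsub>C\<^esub> c)" using s(1)[OF a] s(1)[OF b] \<rho>(2)[OF a] c by simp
    then show ?thesis using inj s(1)[OF a] s(1)[OF b] c by (simp add: inj_on_def)
  qed
  then show thesis using that s(1) by blast
qed

context amalgam
begin

text \<open>
  The universal property for right actions on a set \<open>\<Omega>\<close>. Words act by composition, and the defining
  relations are respected, so no group of permutations has to be formed.
\<close>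

lemma amalgam_action:
  fixes \<alpha> :: "'a \<Rightarrow> 'w \<Rightarrow> 'w" and \<beta> :: "'b \<Rightarrow> 'w \<Rightarrow> 'w"
  assumes \<alpha>: "\<And>a \<omega>. a \<in> carrier A \<Longrightarrow> \<omega> \<in> \<Omega> \<Longrightarrow> \<alpha> a \<omega> \<in> \<Omega>"
    and \<alpha>1: "\<And>\<omega>. \<omega> \<in> \<Omega> \<Longrightarrow> \<alpha> \<one>\<^bsub>A\<^esub> \<omega> = \<omega>"
    and \<alpha>m: "\<And>a a' \<omega>. a \<in> carrier A \<Longrightarrow> a' \<in> carrier A \<Longrightarrow> \<omega> \<in> \<Omega> \<Longrightarrow> \<alpha> (a \<otimes>\<^bsub>A\<^esub> a') \<omega> = \<alpha> a' (\<alpha> a \<omega>)"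
    and \<beta>: "\<And>b \<omega>. b \<in> carrier B \<Longrightarrow> \<omega> \<in> \<Omega> \<Longrightarrow> \<beta> b \<omega> \<in> \<Omega>"
    and \<beta>1: "\<And>\<omega>. \<omega> \<in> \<Omega> \<Longrightarrow> \<beta> \<one>\<^bsub>B\<^esub> \<omega> = \<omega>"
    and \<beta>m: "\<And>b b' \<omega>. b \<in> carrier B \<Longrightarrow> b' \<in> carrier B \<Longrightarrow> \<omega> \<in> \<Omega> \<Longrightarrow> \<beta> (b \<otimes>\<^bsub>B\<^esub> b') \<omega> = \<beta> b' (\<beta> b \<omega>)"
    and glue: "\<And>c \<omega>. c \<in> carrier C \<Longrightarrow> \<omega> \<in> \<Omega> \<Longrightarrow> \<alpha> (i c) \<omega> = \<beta> (j c) \<omega>"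
  obtains act where "\<And>\<omega>. \<omega> \<in> \<Omega> \<Longrightarrow> act \<one>\<^bsub>P\<^esub> \<omega> = \<omega>"
    and "\<And>x a \<omega>. x \<in> carrier P \<Longrightarrow> a \<in> carrier A \<Longrightarrow> \<omega> \<in> \<Omega> \<Longrightarrow> act (x \<otimes>\<^bsub>P\<^esub> \<iota>\<^sub>A a) \<omega> = \<alpha> a (act x \<omega>)"
    and "\<And>x b \<omega>. x \<in> carrier P \<Longrightarrow> b \<in> carrier B \<Longrightarrow> \<omega> \<in> \<Omega> \<Longrightarrow> act (x \<otimes>\<^bsub>P\<^esub> \<iota>\<^sub>B b) \<omega> = \<beta> b (act x \<omega>)"
proof -
  define run where "run = fold (case_sum \<alpha> \<beta>)"
  have closed: "run w \<omega> \<in> \<Omega>" if "w \<in> amalg_words A B" "\<omega> \<in> \<Omega>" for w \<omega>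
    using that
  proof (induction w arbitrary: \<omega>)
    case (Cons x w)
    then have "case_sum \<alpha> \<beta> x \<omega> \<in> \<Omega>" using \<alpha> \<beta> by (auto split: sum.splits)
    then show ?case using Cons by (simp add: run_def)
  qed (simp add: run_def)
  have append: "run (u @ v) \<omega> = run v (run u \<omega>)" for u v \<omega> by (simp add: run_def)
  have rel: "\<forall>\<omega>\<in>\<Omega>. run u \<omega> = run v \<omega>" if "(u, v) \<in> rel" for u v
    using that
  proof (induction rule: amalg_rel.induct)
    case (append u u' v v')
    then have "u' \<in> amalg_words A B" using rel_words by blast
    then show ?case using append.IH closed by (simp add: \<open>\<And>u v \<omega>. run (u @ v) \<omega> = run v (run u \<omega>)\<close>)
  qed (simp_all add: run_def \<alpha>1 \<alpha>m \<beta>1 \<beta>m glue)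
  define act where "act K = run (SOME w. w \<in> K)" for K
  have act: "act (cls w) \<omega> = run w \<omega>" if "w \<in> amalg_words A B" "\<omega> \<in> \<Omega>" for w \<omega>
  proof -
    have "w \<in> cls w" using that by (auto intro: amalg_rel.refl)
    then have "(SOME w'. w' \<in> cls w) \<in> cls w" by (rule someI)
    then show ?thesis using rel that(2) by (simp add: act_def)
  qed
  have act_snoc: "act (x \<otimes>\<^bsub>P\<^esub> cls [l]) \<omega> = case_sum \<alpha> \<beta> l (act x \<omega>)"
    if x: "x \<in> carrier P" and l: "l \<in> carrier A <+> carrier B" and \<omega>: "\<omega> \<in> \<Omega>" for x l \<omega>
  proof -
    obtain w where w: "w \<in> amalg_words A B" "x = cls w" using x by (auto simp: carrier_P)
    have wl: "w @ [l] \<in> amalg_words A B" "[l] \<in> amalg_words A B" using w(1) l by auto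
    have "act (x \<otimes>\<^bsub>P\<^esub> cls [l]) \<omega> = run (w @ [l]) \<omega>"
      unfolding w(2) mult_P[OF w(1) wl(2)] by (rule act[OF wl(1) \<omega>])
    also have "\<dots> = case_sum \<alpha> \<beta> l (run w \<omega>)" by (simp add: run_def)
    finally show ?thesis unfolding w(2) act[OF w(1) \<omega>] .
  qed
  show thesis
  proof (rule that)
    show "act \<one>\<^bsub>P\<^esub> \<omega> = \<omega>" if "\<omega> \<in> \<Omega>" for \<omega>
      using act[of "[]" \<omega>] that by (simp add: one_P run_def)
    show "act (x \<otimes>\<^bsub>P\<^esub> \<iota>\<^sub>A a) \<omega> = \<alpha> a (act x \<omega>)"
      if "x \<in> carrier P" "a \<in> carrier A" "\<omega> \<in> \<Omega>" for x a \<omega>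
      using act_snoc[of x "Inl a" \<omega>] that by (auto simp: \<iota>\<^sub>A_def)
    show "act (x \<otimes>\<^bsub>P\<^esub> \<iota>\<^sub>B b) \<omega> = \<beta> b (act x \<omega>)"
      if "x \<in> carrier P" "b \<in> carrier B" "\<omega> \<in> \<Omega>" for x b \<omega>
      using act_snoc[of x "Inr b" \<omega>] that by (auto simp: \<iota>\<^sub>B_def)
  qed
qed

lemma \<iota>_closed [simp]: "a \<in> carrier A \<Longrightarrow> \<iota>\<^sub>A a \<in> carrier P" "b \<in> carrier B \<Longrightarrow> \<iota>\<^sub>B b \<in> carrier P"
  using \<iota>\<^sub>A_hom \<iota>\<^sub>B_hom by (auto simp: hom_def)

lemma amalgam_induct [consumes 1, case_names one left right]:
  assumes "x \<in> carrier P" and "Q \<one>\<^bsub>P\<^esub>"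
    and "\<And>x a. x \<in> carrier P \<Longrightarrow> Q x \<Longrightarrow> a \<in> carrier A \<Longrightarrow> Q (x \<otimes>\<^bsub>P\<^esub> \<iota>\<^sub>A a)"
    and "\<And>x b. x \<in> carrier P \<Longrightarrow> Q x \<Longrightarrow> b \<in> carrier B \<Longrightarrow> Q (x \<otimes>\<^bsub>P\<^esub> \<iota>\<^sub>B b)"
  shows "Q x"
proof -
  have "w \<in> amalg_words A B \<Longrightarrow> Q (cls w)" for w
  proof (induction w rule: rev_induct)
    case Nil
    then show ?case using assms(2) by (simp add: one_P)
  next
    case (snoc l w)
    then have w: "w \<in> amalg_words A B" "[l] \<in> amalg_words A B" by auto
    have c: "cls w \<in> carrier P" unfolding carrier_P using w(1) by (rule imageI)
    have eq: "cls (w @ [l]) = cls w \<otimes>\<^bsub>P\<^esub> cls [l]" using mult_P[OF w] by simp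
    show ?case
    proof (cases l)
      case (Inl a)
      then show ?thesis unfolding eq using assms(3)[OF c snoc.IH[OF w(1)], of a] w(2)
        by (auto simp: \<iota>\<^sub>A_def)
    next
      case (Inr b)
      then show ?thesis unfolding eq using assms(4)[OF c snoc.IH[OF w(1)], of b] w(2)
        by (auto simp: \<iota>\<^sub>B_def)
    qed
  qed
  then show ?thesis using assms(1) by (auto simp: carrier_P)
qed

text \<open>
  \<open>A\<close> acts freely on the first factor of \<open>A \<times> B\<close> and \<open>B\<close> on the second. The restrictions of these
  actions to \<open>C\<close> are isomorphic: the equivariant maps \<open>s\<close> and \<open>t\<close> define an involution \<open>\<theta>\<close> that
  exchanges them, by swapping the \<open>C\<close>-coordinates \<open>s a\<close> and \<open>t b\<close>. After conjugating the action of \<open>B\<close>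
  by \<open>\<theta>\<close> the two agree on \<open>C\<close> and define an action of the amalgam in which both factors act freely.
\<close>

lemma \<iota>_inj: "inj_on \<iota>\<^sub>A (carrier A)" "inj_on \<iota>\<^sub>B (carrier B)"
proof -
  have hom: "i \<in> hom C A" "j \<in> hom C B" using i j by (auto simp: mon_def)
  interpret i: group_hom C A i by unfold_locales (rule hom(1))
  interpret j: group_hom C B j by unfold_locales (rule hom(2))
  note i.hom_mult [simp del] i.hom_inv [simp del] j.hom_mult [simp del] j.hom_inv [simp del]
  obtain s where s: "\<And>a. a \<in> carrier A \<Longrightarrow> s a \<in> carrier C"
    "\<And>a c. a \<in> carrier A \<Longrightarrow> c \<in> carrier C \<Longrightarrow> s (a \<otimes>\<^bsub>A\<^esub> i c) = s a \<otimes>\<^bsub>C\<^esub> c"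
    using equivariant_section[OF A.group_axioms C.group_axioms i] by blast
  obtain t where t: "\<And>b. b \<in> carrier B \<Longrightarrow> t b \<in> carrier C"
    "\<And>b c. b \<in> carrier B \<Longrightarrow> c \<in> carrier C \<Longrightarrow> t (b \<otimes>\<^bsub>B\<^esub> j c) = t b \<otimes>\<^bsub>C\<^esub> c"
    using equivariant_section[OF B.group_axioms C.group_axioms j] by blast
  define \<Omega> where "\<Omega> = carrier A \<times> carrier B"
  have cancel: "x \<otimes>\<^bsub>C\<^esub> (inv\<^bsub>C\<^esub> x \<otimes>\<^bsub>C\<^esub> y) = y" "inv\<^bsub>C\<^esub> x \<otimes>\<^bsub>C\<^esub> y \<otimes>\<^bsub>C\<^esub> (inv\<^bsub>C\<^esub> y \<otimes>\<^bsub>C\<^esub> x) = \<one>\<^bsub>C\<^esub>"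
    "c \<otimes>\<^bsub>C\<^esub> (inv\<^bsub>C\<^esub> (x \<otimes>\<^bsub>C\<^esub> c) \<otimes>\<^bsub>C\<^esub> y) = inv\<^bsub>C\<^esub> x \<otimes>\<^bsub>C\<^esub> y"
    if "x \<in> carrier C" "y \<in> carrier C" "c \<in> carrier C" for x y c
  proof -
    have *: "u \<otimes>\<^bsub>C\<^esub> (inv\<^bsub>C\<^esub> u \<otimes>\<^bsub>C\<^esub> v) = v" if "u \<in> carrier C" "v \<in> carrier C" for u v
      using that by (simp flip: C.m_assoc)
    show "x \<otimes>\<^bsub>C\<^esub> (inv\<^bsub>C\<^esub> x \<otimes>\<^bsub>C\<^esub> y) = y" "inv\<^bsub>C\<^esub> x \<otimes>\<^bsub>C\<^esub> y \<otimes>\<^bsub>C\<^esub> (inv\<^bsub>C\<^esub> y \<otimes>\<^bsub>C\<^esub> x) = \<one>\<^bsub>C\<^esub>"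
      "c \<otimes>\<^bsub>C\<^esub> (inv\<^bsub>C\<^esub> (x \<otimes>\<^bsub>C\<^esub> c) \<otimes>\<^bsub>C\<^esub> y) = inv\<^bsub>C\<^esub> x \<otimes>\<^bsub>C\<^esub> y"
      using that * by (simp_all add: C.inv_mult_group C.m_assoc)
  qed
  define \<sigma> where "\<sigma> a b = a \<otimes>\<^bsub>A\<^esub> i (inv\<^bsub>C\<^esub> s a \<otimes>\<^bsub>C\<^esub> t b)" for a b
  define \<tau> where "\<tau> a b = b \<otimes>\<^bsub>B\<^esub> j (inv\<^bsub>C\<^esub> t b \<otimes>\<^bsub>C\<^esub> s a)" for a b
  define \<theta> where "\<theta> \<omega> = (\<sigma> (fst \<omega>) (snd \<omega>), \<tau> (fst \<omega>) (snd \<omega>))" for \<omega>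
  have \<sigma>\<tau>: "\<sigma> a b \<in> carrier A" "\<tau> a b \<in> carrier B" "\<sigma> (\<sigma> a b) (\<tau> a b) = a" "\<tau> (\<sigma> a b) (\<tau> a b) = b"
    if ab: "a \<in> carrier A" "b \<in> carrier B" for a b
  proof -
    note st = s(1)[OF ab(1)] t(1)[OF ab(2)]
    show c: "\<sigma> a b \<in> carrier A" "\<tau> a b \<in> carrier B" using ab st by (simp_all add: \<sigma>_def \<tau>_def)
    have s': "s (\<sigma> a b) = t b" using ab st by (simp add: \<sigma>_def s(2) cancel(1)[of _ _ "s a"])
    have t': "t (\<tau> a b) = s a" using ab st by (simp add: \<tau>_def t(2) cancel(1)[of _ _ "s a"])
    have "\<sigma> (\<sigma> a b) (\<tau> a b) = \<sigma> a b \<otimes>\<^bsub>A\<^esub> i (inv\<^bsub>C\<^esub> t b \<otimes>\<^bsub>C\<^esub> s a)"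
      unfolding \<sigma>_def[of "\<sigma> a b"] s' t' ..
    also have "\<dots> = a \<otimes>\<^bsub>A\<^esub> i (inv\<^bsub>C\<^esub> s a \<otimes>\<^bsub>C\<^esub> t b \<otimes>\<^bsub>C\<^esub> (inv\<^bsub>C\<^esub> t b \<otimes>\<^bsub>C\<^esub> s a))"
      unfolding \<sigma>_def using ab st by (simp add: A.m_assoc flip: i.hom_mult)
    finally show "\<sigma> (\<sigma> a b) (\<tau> a b) = a" using ab st by (simp add: cancel(2)[of _ _ "s a"])
    have "\<tau> (\<sigma> a b) (\<tau> a b) = \<tau> a b \<otimes>\<^bsub>B\<^esub> j (inv\<^bsub>C\<^esub> s a \<otimes>\<^bsub>C\<^esub> t b)"
      unfolding \<tau>_def[of "\<sigma> a b"] s' t' ..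
    also have "\<dots> = b \<otimes>\<^bsub>B\<^esub> j (inv\<^bsub>C\<^esub> t b \<otimes>\<^bsub>C\<^esub> s a \<otimes>\<^bsub>C\<^esub> (inv\<^bsub>C\<^esub> s a \<otimes>\<^bsub>C\<^esub> t b))"
      unfolding \<tau>_def using ab st by (simp add: B.m_assoc flip: j.hom_mult)
    finally show "\<tau> (\<sigma> a b) (\<tau> a b) = b" using ab st by (simp add: cancel(2)[of _ _ "s a"])
  qed
  have \<theta>: "\<theta> \<omega> \<in> \<Omega>" "\<theta> (\<theta> \<omega>) = \<omega>" if "\<omega> \<in> \<Omega>" for \<omega>
    using that \<sigma>\<tau> by (auto simp: \<Omega>_def \<theta>_def)
  have \<theta>_C: "\<theta> (a \<otimes>\<^bsub>A\<^esub> i c, b) = (\<sigma> a b, \<tau> a b \<otimes>\<^bsub>B\<^esub> j c)"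
    if ab: "a \<in> carrier A" "b \<in> carrier B" and c: "c \<in> carrier C" for a b c
  proof -
    note st = s(1)[OF ab(1)] t(1)[OF ab(2)]
    have "\<sigma> (a \<otimes>\<^bsub>A\<^esub> i c) b = a \<otimes>\<^bsub>A\<^esub> i (c \<otimes>\<^bsub>C\<^esub> (inv\<^bsub>C\<^esub> (s a \<otimes>\<^bsub>C\<^esub> c) \<otimes>\<^bsub>C\<^esub> t b))"
      unfolding \<sigma>_def using ab c st by (simp add: s(2) A.m_assoc flip: i.hom_mult)
    also have "\<dots> = \<sigma> a b" unfolding \<sigma>_def cancel(3)[OF st c] ..
    finally show ?thesis
      using ab c st by (simp add: \<theta>_def \<tau>_def s(2) B.m_assoc C.m_assoc flip: j.hom_mult)
  qed
  define \<alpha> :: "'a \<Rightarrow> 'a \<times> 'b \<Rightarrow> 'a \<times> 'b" where "\<alpha> a \<omega> = (fst \<omega> \<otimes>\<^bsub>A\<^esub> a, snd \<omega>)" for a \<omega>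
  define \<rho> :: "'b \<Rightarrow> 'a \<times> 'b \<Rightarrow> 'a \<times> 'b" where "\<rho> b \<omega> = (fst \<omega>, snd \<omega> \<otimes>\<^bsub>B\<^esub> b)" for b \<omega>
  define \<beta> where "\<beta> b \<omega> = \<theta> (\<rho> b (\<theta> \<omega>))" for b \<omega>
  have \<alpha>: "\<alpha> a \<omega> \<in> \<Omega>" if "a \<in> carrier A" "\<omega> \<in> \<Omega>" for a \<omega> using that by (auto simp: \<alpha>_def \<Omega>_def)
  have \<rho>: "\<rho> b \<omega> \<in> \<Omega>" if "b \<in> carrier B" "\<omega> \<in> \<Omega>" for b \<omega> using that by (auto simp: \<rho>_def \<Omega>_def)
  have \<rho>m: "\<rho> (b \<otimes>\<^bsub>B\<^esub> b') \<omega> = \<rho> b' (\<rho> b \<omega>)" if "b \<in> carrier B" "b' \<in> carrier B" "\<omega> \<in> \<Omega>" for b b' \<omega>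
    using that by (auto simp: \<rho>_def \<Omega>_def B.m_assoc)
  have \<rho>1: "\<rho> \<one>\<^bsub>B\<^esub> \<omega> = \<omega>" if "\<omega> \<in> \<Omega>" for \<omega> using that by (auto simp: \<rho>_def \<Omega>_def)
  have glue: "\<alpha> (i c) \<omega> = \<beta> (j c) \<omega>" if "c \<in> carrier C" "\<omega> \<in> \<Omega>" for c \<omega>
  proof -
    have "\<theta> (\<alpha> (i c) \<omega>) = \<rho> (j c) (\<theta> \<omega>)"
      using that \<theta>_C by (auto simp: \<alpha>_def \<rho>_def \<theta>_def \<Omega>_def)
    then show ?thesis unfolding \<beta>_def using \<theta>(2)[OF \<alpha>] that by (metis i_closed)
  qed
  obtain act where act: "\<And>\<omega>. \<omega> \<in> \<Omega> \<Longrightarrow> act \<one>\<^bsub>P\<^esub> \<omega> = \<omega>"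
    "\<And>x a \<omega>. x \<in> carrier P \<Longrightarrow> a \<in> carrier A \<Longrightarrow> \<omega> \<in> \<Omega> \<Longrightarrow> act (x \<otimes>\<^bsub>P\<^esub> \<iota>\<^sub>A a) \<omega> = \<alpha> a (act x \<omega>)"
    "\<And>x b \<omega>. x \<in> carrier P \<Longrightarrow> b \<in> carrier B \<Longrightarrow> \<omega> \<in> \<Omega> \<Longrightarrow> act (x \<otimes>\<^bsub>P\<^esub> \<iota>\<^sub>B b) \<omega> = \<beta> b (act x \<omega>)"
  proof (rule amalgam_action[of \<Omega> \<alpha> \<beta>])
    show "\<alpha> \<one>\<^bsub>A\<^esub> \<omega> = \<omega>" if "\<omega> \<in> \<Omega>" for \<omega> using that by (auto simp: \<alpha>_def \<Omega>_def)
    show "\<alpha> (a \<otimes>\<^bsub>A\<^esub> a') \<omega> = \<alpha> a' (\<alpha> a \<omega>)"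
      if "a \<in> carrier A" "a' \<in> carrier A" "\<omega> \<in> \<Omega>" for a a' \<omega>
      using that by (auto simp: \<alpha>_def \<Omega>_def A.m_assoc)
    show "\<beta> b \<omega> \<in> \<Omega>" if "b \<in> carrier B" "\<omega> \<in> \<Omega>" for b \<omega>
      unfolding \<beta>_def by (intro \<theta> \<rho> that)
    show "\<beta> \<one>\<^bsub>B\<^esub> \<omega> = \<omega>" if "\<omega> \<in> \<Omega>" for \<omega> unfolding \<beta>_def using \<theta> \<rho>1 that by simp
    show "\<beta> (b \<otimes>\<^bsub>B\<^esub> b') \<omega> = \<beta> b' (\<beta> b \<omega>)"
      if "b \<in> carrier B" "b' \<in> carrier B" "\<omega> \<in> \<Omega>" for b b' \<omega>
      unfolding \<beta>_def using that \<theta> \<rho> \<rho>m by simp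
  qed (use \<alpha> glue in auto)
  have act\<^sub>A: "act (\<iota>\<^sub>A a) \<omega> = \<alpha> a \<omega>" if "a \<in> carrier A" "\<omega> \<in> \<Omega>" for a \<omega>
    using act(2)[of "\<one>\<^bsub>P\<^esub>" a \<omega>] act(1) that by simp
  have act\<^sub>B: "act (\<iota>\<^sub>B b) \<omega> = \<beta> b \<omega>" if "b \<in> carrier B" "\<omega> \<in> \<Omega>" for b \<omega>
    using act(3)[of "\<one>\<^bsub>P\<^esub>" b \<omega>] act(1) that by simp
  have unit: "(\<one>\<^bsub>A\<^esub>, \<one>\<^bsub>B\<^esub>) \<in> \<Omega>" by (simp add: \<Omega>_def)
  have free\<^sub>A: "fst (act (\<iota>\<^sub>A a) (\<one>\<^bsub>A\<^esub>, \<one>\<^bsub>B\<^esub>)) = a" if "a \<in> carrier A" for a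
    using act\<^sub>A[OF that unit] that by (simp add: \<alpha>_def)
  have free\<^sub>B: "snd (\<theta> (act (\<iota>\<^sub>B b) (\<theta> (\<one>\<^bsub>A\<^esub>, \<one>\<^bsub>B\<^esub>)))) = b" if b: "b \<in> carrier B" for b
    using act\<^sub>B[OF b \<theta>(1)[OF unit]] \<theta>(2)[OF unit] \<theta>(2)[OF \<rho>[OF b unit]] b
    by (simp add: \<beta>_def) (simp add: \<rho>_def)
  show "inj_on \<iota>\<^sub>A (carrier A)" by (rule inj_onI) (metis free\<^sub>A)
  show "inj_on \<iota>\<^sub>B (carrier B)" by (rule inj_onI) (metis free\<^sub>B)
qed

definition edge_group where "edge_group = (\<lambda>c. \<iota>\<^sub>A (i c)) ` carrier C"

lemma generate_factors: "generate P (\<iota>\<^sub>A ` carrier A \<union> \<iota>\<^sub>B ` carrier B) = carrier P"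
proof
  show "generate P (\<iota>\<^sub>A ` carrier A \<union> \<iota>\<^sub>B ` carrier B) \<subseteq> carrier P"
    by (rule P.generate_incl) auto
  show "carrier P \<subseteq> generate P (\<iota>\<^sub>A ` carrier A \<union> \<iota>\<^sub>B ` carrier B)"
  proof
    fix x assume "x \<in> carrier P"
    then show "x \<in> generate P (\<iota>\<^sub>A ` carrier A \<union> \<iota>\<^sub>B ` carrier B)"
      by (induction rule: amalgam_induct) (auto intro: generate.intros)
  qed
qed

text \<open>
  \<open>f x\<close> records on which side of the edge \<open>C\<close> the edge of \<open>x\<close> lies. The bit is to be kept by \<open>B\<close> and
  flipped by \<open>A\<close> on entering or leaving \<open>C\<close>. On pairs of an element and a bit, \<open>A\<close> then acts by right
  translations conjugated with the map that flips the bit over \<open>C\<close>. This map commutes with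
  translations by \<open>C\<close>, so the actions of \<open>A\<close> and \<open>B\<close> agree on \<open>C\<close>.
\<close>

lemma half_space_exists:
  obtains f where "\<And>x b. x \<in> carrier P \<Longrightarrow> b \<in> carrier B \<Longrightarrow> f (x \<otimes>\<^bsub>P\<^esub> \<iota>\<^sub>B b) = f x"
    and "\<And>x a. x \<in> carrier P \<Longrightarrow> a \<in> carrier A \<Longrightarrow>
      f (x \<otimes>\<^bsub>P\<^esub> \<iota>\<^sub>A a) = ((f x \<noteq> (x \<in> edge_group)) \<noteq> (x \<otimes>\<^bsub>P\<^esub> \<iota>\<^sub>A a \<in> edge_group))"
    and "f \<one>\<^bsub>P\<^esub> = False"
proof -
  define \<Omega> :: "(('a + 'b) list set \<times> bool) set" where "\<Omega> = carrier P \<times> UNIV"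
  define \<alpha> where "\<alpha> a \<omega> = (fst \<omega> \<otimes>\<^bsub>P\<^esub> \<iota>\<^sub>A a,
    (snd \<omega> \<noteq> (fst \<omega> \<in> edge_group)) \<noteq> (fst \<omega> \<otimes>\<^bsub>P\<^esub> \<iota>\<^sub>A a \<in> edge_group))" for a \<omega>
  define \<beta> where "\<beta> b \<omega> = (fst \<omega> \<otimes>\<^bsub>P\<^esub> \<iota>\<^sub>B b, snd \<omega> :: bool)" for b \<omega>
  interpret \<iota>A: group_hom A P \<iota>\<^sub>A by unfold_locales (rule \<iota>\<^sub>A_hom)
  interpret \<iota>B: group_hom B P \<iota>\<^sub>B by unfold_locales (rule \<iota>\<^sub>B_hom)
  have edge: "x \<otimes>\<^bsub>P\<^esub> \<iota>\<^sub>A (i c) \<in> edge_group \<longleftrightarrow> x \<in> edge_group"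
    if "x \<in> carrier P" "c \<in> carrier C" for x c
  proof -
    have hom: "i \<in> hom C A" using i by (simp add: mon_def)
    interpret i: group_hom C A i by unfold_locales (rule hom)
    have *: "y \<otimes>\<^bsub>P\<^esub> \<iota>\<^sub>A (i c) \<in> edge_group" if "y \<in> edge_group" "c \<in> carrier C" for y c
      using that by (auto simp: edge_group_def simp flip: \<iota>A.hom_mult i.hom_mult)
    have "x = x \<otimes>\<^bsub>P\<^esub> \<iota>\<^sub>A (i c) \<otimes>\<^bsub>P\<^esub> \<iota>\<^sub>A (i (inv\<^bsub>C\<^esub> c))"
      using that by (simp add: P.m_assoc flip: \<iota>A.hom_mult i.hom_mult del: i.hom_inv)
    then show ?thesis using *[of x c] *[of "x \<otimes>\<^bsub>P\<^esub> \<iota>\<^sub>A (i c)" "inv\<^bsub>C\<^esub> c"] that by auto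
  qed
  obtain act where act: "\<And>\<omega>. \<omega> \<in> \<Omega> \<Longrightarrow> act \<one>\<^bsub>P\<^esub> \<omega> = \<omega>"
    "\<And>x a \<omega>. x \<in> carrier P \<Longrightarrow> a \<in> carrier A \<Longrightarrow> \<omega> \<in> \<Omega> \<Longrightarrow> act (x \<otimes>\<^bsub>P\<^esub> \<iota>\<^sub>A a) \<omega> = \<alpha> a (act x \<omega>)"
    "\<And>x b \<omega>. x \<in> carrier P \<Longrightarrow> b \<in> carrier B \<Longrightarrow> \<omega> \<in> \<Omega> \<Longrightarrow> act (x \<otimes>\<^bsub>P\<^esub> \<iota>\<^sub>B b) \<omega> = \<beta> b (act x \<omega>)"
  proof (rule amalgam_action[of \<Omega> \<alpha> \<beta>])
    show "\<alpha> (a \<otimes>\<^bsub>A\<^esub> a') \<omega> = \<alpha> a' (\<alpha> a \<omega>)"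
      if "a \<in> carrier A" "a' \<in> carrier A" "\<omega> \<in> \<Omega>" for a a' \<omega>
    proof -
      have "fst \<omega> \<otimes>\<^bsub>P\<^esub> \<iota>\<^sub>A (a \<otimes>\<^bsub>A\<^esub> a') = fst \<omega> \<otimes>\<^bsub>P\<^esub> \<iota>\<^sub>A a \<otimes>\<^bsub>P\<^esub> \<iota>\<^sub>A a'"
        using that by (auto simp: \<Omega>_def P.m_assoc)
      then show ?thesis unfolding \<alpha>_def by auto
    qed
    show "\<alpha> (i c) \<omega> = \<beta> (j c) \<omega>" if "c \<in> carrier C" "\<omega> \<in> \<Omega>" for c \<omega>
      using that edge by (auto simp: \<alpha>_def \<beta>_def \<Omega>_def simp flip: \<iota>_glue)
  qed (auto simp: \<alpha>_def \<beta>_def \<Omega>_def P.m_assoc)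
  have base: "(\<one>\<^bsub>P\<^esub>, False) \<in> \<Omega>" by (simp add: \<Omega>_def)
  \<comment> \<open>The first coordinate tracks the element itself, so membership in \<open>C\<close> in the definition of
    \<open>\<alpha>\<close> becomes membership of \<open>x\<close>.\<close>
  have fst: "fst (act x (\<one>\<^bsub>P\<^esub>, False)) = x" if "x \<in> carrier P" for x
    using that
    by (induction rule: amalgam_induct) (simp_all add: act base \<alpha>_def \<beta>_def)
  show thesis
  proof (rule that[of "\<lambda>x. snd (act x (\<one>\<^bsub>P\<^esub>, False))"])
  qed (simp_all add: act base \<alpha>_def \<beta>_def fst)
qed

text \<open>
  Elements of \<open>B\<close> keep the bit \<open>False\<close> of \<open>\<one>\<close>, whereas elements of \<open>A\<close> outside \<open>C\<close> leave the edge
  exactly once and get the bit \<open>True\<close>. In particular \<open>A\<close> and \<open>B\<close> meet only in \<open>C\<close> inside the amalgam,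
  and removing \<open>C\<close> leaves the two half-spaces.
\<close>

lemma amalgam_splitting:
  obtains H where "splitting P (\<lambda>t. if t then \<iota>\<^sub>A ` carrier A else \<iota>\<^sub>B ` carrier B) edge_group H"
proof -
  interpret \<iota>A: group_hom A P \<iota>\<^sub>A by unfold_locales (rule \<iota>\<^sub>A_hom)
  interpret \<iota>B: group_hom B P \<iota>\<^sub>B by unfold_locales (rule \<iota>\<^sub>B_hom)
  have hom: "i \<in> hom C A" using i by (simp add: mon_def)
  interpret i: group_hom C A i by unfold_locales (rule hom)
  have "(\<iota>\<^sub>A \<circ> i) \<in> hom C P" using hom \<iota>\<^sub>A_hom by (rule hom_compose)
  then interpret \<iota>i: group_hom C P "\<iota>\<^sub>A \<circ> i" by unfold_locales
  obtain f where fB: "\<And>x b. x \<in> carrier P \<Longrightarrow> b \<in> carrier B \<Longrightarrow> f (x \<otimes>\<^bsub>P\<^esub> \<iota>\<^sub>B b) = f x"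
    and fA: "\<And>x a. x \<in> carrier P \<Longrightarrow> a \<in> carrier A \<Longrightarrow>
      f (x \<otimes>\<^bsub>P\<^esub> \<iota>\<^sub>A a) = ((f x \<noteq> (x \<in> edge_group)) \<noteq> (x \<otimes>\<^bsub>P\<^esub> \<iota>\<^sub>A a \<in> edge_group))"
    and f1: "f \<one>\<^bsub>P\<^esub> = False"
    using half_space_exists by blast
  have edgeA: "edge_group \<subseteq> \<iota>\<^sub>A ` carrier A" by (auto simp: edge_group_def)
  have edgeB: "edge_group \<subseteq> \<iota>\<^sub>B ` carrier B" by (auto simp: edge_group_def \<iota>_glue)
  have one: "\<one>\<^bsub>P\<^esub> \<in> edge_group"
    unfolding edge_group_def by (rule image_eqI[of _ _ "\<one>\<^bsub>C\<^esub>"]) simp_all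
  have f_B: "\<not> f x" if "x \<in> \<iota>\<^sub>B ` carrier B" for x
    using that fB[of "\<one>\<^bsub>P\<^esub>"] f1 by auto
  have f_A: "f x" if "x \<in> \<iota>\<^sub>A ` carrier A" "x \<notin> edge_group" for x
    using that fA[of "\<one>\<^bsub>P\<^esub>"] f1 one by auto
  define H where "H t = {x \<in> carrier P. f x = t \<and> x \<notin> edge_group}" for t
  let ?F = "\<lambda>t. if t then \<iota>\<^sub>A ` carrier A else \<iota>\<^sub>B ` carrier B"
  have "splitting P ?F edge_group H"
  proof (rule splitting.intro[OF P.group_axioms splitting_axioms.intro])
    show "subgroup (?F t) P" for t
      using \<iota>A.img_is_subgroup \<iota>B.img_is_subgroup by simp
    show "subgroup edge_group P"
      using \<iota>i.img_is_subgroup by (simp add: edge_group_def image_comp comp_def)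
    show "edge_group \<subseteq> ?F t" for t using edgeA edgeB by simp
    show "generate P (?F True \<union> ?F False) = carrier P" using generate_factors by simp
    show "carrier P = edge_group \<union> H t \<union> H (\<not> t)" for t
      using edgeA by (auto simp: H_def)
    show "H t \<inter> H (\<not> t) = {}" "edge_group \<inter> H t = {}" for t by (auto simp: H_def)
    fix h t f' assume h: "h \<in> H t"
    then have hP: "h \<in> carrier P" "h \<notin> edge_group" "f h = t" by (auto simp: H_def)
    show "h \<otimes>\<^bsub>P\<^esub> f' \<in> H t \<union> edge_group" if "f' \<in> ?F t"
      using that hP fA fB by (cases t) (auto simp: H_def)
    show "h \<otimes>\<^bsub>P\<^esub> f' \<in> H t" if f': "f' \<in> ?F (\<not> t)"
    proof (cases t)
      case True
      then obtain b where b: "b \<in> carrier B" "f' = \<iota>\<^sub>B b" using f' by auto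
      then have "f (h \<otimes>\<^bsub>P\<^esub> f')" using fB hP True by simp
      then show ?thesis using True b hP edgeB f_B by (auto simp: H_def)
    next
      case False
      then obtain a where a: "a \<in> carrier A" "f' = \<iota>\<^sub>A a" using f' by auto
      then have "f (h \<otimes>\<^bsub>P\<^esub> f') = (h \<otimes>\<^bsub>P\<^esub> f' \<in> edge_group)" using fA hP False by simp
      then show ?thesis using False a hP edgeB f_B by (auto simp: H_def)
    qed
  next
    fix x t assume "x \<in> ?F t" "x \<notin> edge_group"
    then show "x \<in> H t" using f_A f_B by (cases t) (auto simp: H_def)
  qed
  then show thesis by (rule that)
qed

lemma finite_generating_set_amalgam:
  assumes S: "finite_generating_set A S" and T: "finite_generating_set B T"
  shows "finite_generating_set P (\<iota>\<^sub>A ` S \<union> \<iota>\<^sub>B ` T)"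
proof -
  interpret \<iota>A: group_hom A P \<iota>\<^sub>A by unfold_locales (rule \<iota>\<^sub>A_hom)
  interpret \<iota>B: group_hom B P \<iota>\<^sub>B by unfold_locales (rule \<iota>\<^sub>B_hom)
  let ?R = "\<iota>\<^sub>A ` S \<union> \<iota>\<^sub>B ` T"
  have ST: "finite S" "S \<subseteq> carrier A" "generate A S = carrier A"
    "finite T" "T \<subseteq> carrier B" "generate B T = carrier B"
    using S T by (auto simp: finite_generating_set_def)
  have R: "?R \<subseteq> carrier P" using ST by auto
  have "\<iota>\<^sub>A ` carrier A = generate P (\<iota>\<^sub>A ` S)" "\<iota>\<^sub>B ` carrier B = generate P (\<iota>\<^sub>B ` T)"
    using \<iota>A.generate_img[of S] \<iota>B.generate_img[of T] ST by simp_all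
  then have sub: "\<iota>\<^sub>A ` carrier A \<subseteq> generate P ?R" "\<iota>\<^sub>B ` carrier B \<subseteq> generate P ?R"
    using P.mono_generate[of "\<iota>\<^sub>A ` S" ?R] P.mono_generate[of "\<iota>\<^sub>B ` T" ?R] by auto
  have "x \<in> generate P ?R" if "x \<in> carrier P" for x
    using that
  proof (induction rule: amalgam_induct)
    case one
    show ?case by (rule generate.one)
  next
    case (left x a)
    then show ?case using sub(1) by (blast intro: generate.eng)
  next
    case (right x b)
    then show ?case using sub(2) by (blast intro: generate.eng)
  qed
  then have "generate P ?R = carrier P" using P.generate_incl[OF R] by blast
  then show ?thesis using R ST by (simp add: finite_generating_set_def)
qed

text \<open>
  The geometric argument needs generators from the factors; the last step passes from the generating
  set \<open>\<iota>\<^sub>A ` S \<union> \<iota>\<^sub>B ` T\<close> of this kind to \<open>R\<close>.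
\<close>

lemma asdim_amalgam:
  assumes S: "finite_generating_set A S" and T: "finite_generating_set B T"
    and dim: "asdim_at_most (word_dist A S) n (carrier A)" "asdim_at_most (word_dist B T) n (carrier B)"
    and R: "finite_generating_set P R"
  shows "asdim_at_most (word_dist P R) (2 * n + 1) (carrier P)"
proof -
  let ?R = "\<iota>\<^sub>A ` S \<union> \<iota>\<^sub>B ` T"
  have fgen: "finite_generating_set P ?R" by (rule finite_generating_set_amalgam[OF S T])
  obtain H where H: "splitting P (\<lambda>t. if t then \<iota>\<^sub>A ` carrier A else \<iota>\<^sub>B ` carrier B) edge_group H"
    using amalgam_splitting .
  have letters: "?R \<subseteq> \<iota>\<^sub>A ` carrier A \<union> \<iota>\<^sub>B ` carrier B"
    using S T by (auto simp: finite_generating_set_def)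
  have A: "asdim_at_most (word_dist P ?R) n (\<iota>\<^sub>A ` carrier A)"
    by (rule asdim_at_most_hom_image[OF A.group_axioms P.group_axioms \<iota>\<^sub>A_hom \<iota>_inj(1) S fgen dim(1)])
  have B: "asdim_at_most (word_dist P ?R) n (\<iota>\<^sub>B ` carrier B)"
    by (rule asdim_at_most_hom_image[OF B.group_axioms P.group_axioms \<iota>\<^sub>B_hom \<iota>_inj(2) T fgen dim(2)])
  interpret splitting P "\<lambda>t. if t then \<iota>\<^sub>A ` carrier A else \<iota>\<^sub>B ` carrier B" edge_group H by (rule H)
  interpret metric_splitting P "\<lambda>t. if t then \<iota>\<^sub>A ` carrier A else \<iota>\<^sub>B ` carrier B" edge_group H ?R n
    by unfold_locales (use fgen letters A B in auto)
  have "(\<lambda>x. x) \<in> hom P P" by (simp add: hom_def)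
  from asdim_at_most_hom_image[OF P.group_axioms P.group_axioms this _ fgen R asdim_split_group]
  show ?thesis by simp
qed

end

theorem theorem5:
  fixes A :: "('a, 'm) monoid_scheme" and B :: "('b, 'k) monoid_scheme"
    and C :: "('c, 'l) monoid_scheme"
    and i :: "'c \<Rightarrow> 'a" and j :: "'c \<Rightarrow> 'b"
    and S :: "'a set" and T :: "'b set" and n :: nat
  assumes "group A" and "group B" and "group C"
    and "i \<in> mon C A" and "j \<in> mon C B"
    and "finite_generating_set A S" and "finite_generating_set B T"
    and "Metric_space.asdim_le (carrier A) (word_dist A S) n"
    and "Metric_space.asdim_le (carrier B) (word_dist B T) n"
  shows "(\<exists>R. finite_generating_set (amalgamated_product A B C i j) R) \<and>
    (\<forall>R. finite_generating_set (amalgamated_product A B C i j) R \<longrightarrow>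
       Metric_space.asdim_le (carrier (amalgamated_product A B C i j))
         (word_dist (amalgamated_product A B C i j) R) (2 * n + 1))"
proof -
  have "amalgam A B C i j"
    using assms by (simp add: amalgam_def amalgam_axioms_def)
  then interpret amalgam A B C i j .
  have dim: "asdim_at_most (word_dist A S) n (carrier A)" "asdim_at_most (word_dist B T) n (carrier B)"
    using assms(8,9) Metric_space.asdim_le_iff_asdim_at_most[OF A.word_metric[OF assms(6)]]
      Metric_space.asdim_le_iff_asdim_at_most[OF B.word_metric[OF assms(7)]]
    by simp_all
  have "Metric_space.asdim_le (carrier P) (word_dist P R) (2 * n + 1)"
    if R: "finite_generating_set P R" for R
    using asdim_amalgam[OF assms(6,7) dim R]
      Metric_space.asdim_le_iff_asdim_at_most[OF P.word_metric[OF R]]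
    by simp
  then show ?thesis using finite_generating_set_amalgam[OF assms(6,7)] by blast
qed

end
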